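(* Let $d\ge2$, $\Lambda$ a full rank lattice in $\mathbb{R}^d$ of covolume $1$, $\Lambda^\ast$ its dual lattice, and $k\in\{1,\dots,d\}$. The exponents $\omega_k(\Lambda)$ and $\hat\omega_{d+1-k}(\Lambda^\ast)$ have different signs, or are simultaneously zero. If they are nonzero, let $A$ be the positive one of them and $B$ the negative one. Then \[ \frac{A^{-1}+1}{d-1}\le-(B^{-1}+1)\le(d-1)(A^{-1}+1). \]
   Context: $\Lambda^\ast=\{\mathbf w:\langle\mathbf w,\mathbf z\rangle\in\mathbb{Z}\ \forall\mathbf z\in\Lambda\}$. $|\cdot|$ is the supremum norm, $\Pi(\mathbf v)=\prod_{i=1}^d|v_i|^{1/d}$, and for $\mathbf v\in\mathbb{R}^d$, $\mathcal P(\mathbf v)=\{\mathbf z\in\mathbb{R}^d:|z_i|\le|v_i|,\ i=1,\dots,d\}$. For a lattice $M$, $\omega_k(M)$ is the supremum of real $\gamma$ such that $\mathcal P(\mathbf v)$ contains $k$ linearly independent points of $M$ for some $\mathbf v\in\mathbb{R}^d$ with $\Pi(\mathbf v)=|\mathbf v|^{-\gamma}$ and $|\mathbf v|$ arbitrarily large; $\hat\omega_k(M)$ is the supremum of real $\gamma$ such that $\mathcal P(\mathbf v)$ contains $k$ linearly independent points of $M$ for every $\mathbf v\in\mathbb{R}^d$ with $\Pi(\mathbf v)=|\mathbf v|^{-\gamma}$ and $|\mathbf v|$ large enough. *)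

theory Defs
  imports "HOL-Analysis.Analysis" "HOL-Library.Extended_Real"
begin

definition is_lattice_basis :: "real ^ 'n ^ 'n \<Rightarrow> (real ^ 'n) set \<Rightarrow> bool" where
  "is_lattice_basis B L \<longleftrightarrow> invertible B \<and> L = {B *v z | z. \<forall>i. z $ i \<in> \<int>}"

definition full_rank_lattice :: "(real ^ 'n) set \<Rightarrow> bool" where
  "full_rank_lattice L \<longleftrightarrow> (\<exists>B. is_lattice_basis B L)"

text \<open>Independent of the chosen basis, see \<open>lattice_covolume_eq\<close> below.\<close>

definition lattice_covolume :: "(real ^ 'n) set \<Rightarrow> real" where
  "lattice_covolume L = \<bar>det (SOME B. is_lattice_basis B L)\<bar>"

definition dual_lattice :: "(real ^ 'n) set \<Rightarrow> (real ^ 'n) set" where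
  "dual_lattice L = {w. \<forall>z\<in>L. w \<bullet> z \<in> \<int>}"

definition geo_mean_abs :: "real ^ 'n \<Rightarrow> real" where
  "geo_mean_abs v = (\<Prod>i\<in>UNIV. \<bar>v $ i\<bar> powr (1 / real CARD('n)))"

definition box_of :: "real ^ 'n \<Rightarrow> (real ^ 'n) set" where
  "box_of v = {z. \<forall>i. \<bar>z $ i\<bar> \<le> \<bar>v $ i\<bar>}"

definition has_indep_points :: "nat \<Rightarrow> (real ^ 'n) set \<Rightarrow> real ^ 'n \<Rightarrow> bool" where
  "has_indep_points k M v \<longleftrightarrow>
     (\<exists>S. S \<subseteq> M \<inter> box_of v \<and> finite S \<and> card S = k \<and> independent S)"

text \<open>The exponents can be infinite (the first exponent of the integer lattice is),
  so the suprema are taken in the extended reals.\<close>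

definition lattice_exponent :: "nat \<Rightarrow> (real ^ 'n) set \<Rightarrow> ereal" where
  "lattice_exponent k M = Sup (ereal ` {\<gamma>. \<forall>T. \<exists>v. infnorm v \<ge> T \<and>
      geo_mean_abs v = infnorm v powr (-\<gamma>) \<and> has_indep_points k M v})"

definition uniform_lattice_exponent :: "nat \<Rightarrow> (real ^ 'n) set \<Rightarrow> ereal" where
  "uniform_lattice_exponent k M = Sup (ereal ` {\<gamma>. \<exists>T. \<forall>v. infnorm v \<ge> T \<longrightarrow>
      geo_mean_abs v = infnorm v powr (-\<gamma>) \<longrightarrow> has_indep_points k M v})"

lemma det_integer_entries:
  fixes U :: "real ^ 'n ^ 'n"
  assumes "\<And>i j. U $ i $ j \<in> \<int>"
  shows "det U \<in> \<int>"
  unfolding det_def using assms by (intro Ints_sum Ints_mult Ints_prod) auto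

lemma lattice_basis_change:
  fixes B C :: "real ^ 'n ^ 'n"
  assumes "is_lattice_basis B L" "is_lattice_basis C L"
  obtains U where "C = B ** U" "det U \<in> \<int>"
proof -
  have "\<exists>z. (\<forall>i. z $ i \<in> \<int>) \<and> C *v axis j 1 = B *v z" for j
  proof -
    have "C *v axis j 1 \<in> L"
      using assms(2) unfolding is_lattice_basis_def by (auto simp: axis_def)
    then show ?thesis
      using assms(1) unfolding is_lattice_basis_def by auto
  qed
  then obtain f where f: "\<And>j i. f j $ i \<in> \<int>" "\<And>j. C *v axis j 1 = B *v f j"
    by metis
  define U :: "real ^ 'n ^ 'n" where "U = (\<chi> i j. f j $ i)"
  have "C $ i $ j = (B ** U) $ i $ j" for i j
  proof -
    have "C $ i $ j = (C *v axis j 1) $ i"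
      by (simp add: matrix_vector_mult_basis column_def)
    also have "\<dots> = (B ** U) $ i $ j"
      unfolding f(2) by (simp add: matrix_matrix_mult_def matrix_vector_mult_def U_def)
    finally show ?thesis .
  qed
  then have "C = B ** U" by (simp add: vec_eq_iff)
  moreover have "det U \<in> \<int>"
    by (rule det_integer_entries) (simp add: U_def f(1))
  ultimately show ?thesis using that by blast
qed

lemma lattice_covolume_eq:
  fixes B :: "real ^ 'n ^ 'n"
  assumes "is_lattice_basis B L"
  shows "lattice_covolume L = \<bar>det B\<bar>"
proof -
  define C where "C = (SOME B. is_lattice_basis B L)"
  have C: "is_lattice_basis C L"
    unfolding C_def using assms by (rule someI)
  have le: "\<bar>det X\<bar> \<le> \<bar>det Y\<bar>"
    if "is_lattice_basis X L" "is_lattice_basis Y L" for X Y :: "real ^ 'n ^ 'n"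
  proof -
    obtain U where U: "Y = X ** U" "det U \<in> \<int>"
      using lattice_basis_change \<open>is_lattice_basis X L\<close> \<open>is_lattice_basis Y L\<close> by blast
    have "det Y \<noteq> 0"
      using that(2) by (simp add: is_lattice_basis_def invertible_det_nz)
    then have "\<bar>det U\<bar> \<ge> 1"
      using U by (intro Ints_nonzero_abs_ge1) (auto simp: det_mul)
    then show ?thesis
      using U(1) by (simp add: det_mul abs_mult mult_left_le mult_le_cancel_left1)
  qed
  show ?thesis
    unfolding lattice_covolume_def C_def[symmetric]
    using le[OF C assms] le[OF assms C] by simp
qed

end

theory Submission imports Defs begin

text \<open>Normalising \<open>u = v / \<Pi>(v)\<close>, both exponents describe how the successive minima \<open>\<mu>\<^sub>k\<close> of the
  lattice with respect to the boxes \<open>P(u)\<close> with \<open>\<Pi>(u) = 1\<close> compare with powers of \<open>|u|\<close>. Mahler's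
  transference theorem says that \<open>\<mu>\<^sub>k\<close> for \<open>P(u)\<close> and the dual minimum of index \<open>d + 1 - k\<close> for
  \<open>P(1/u)\<close> have a product bounded above and away from \<open>0\<close>. Since \<open>|1/u| \<le> |u|\<close> to the power
  \<open>d - 1\<close> and conversely, passing from \<open>u\<close> to \<open>1/u\<close> changes the rate of growth by a factor
  between \<open>1 / (d - 1)\<close> and \<open>d - 1\<close>. Mahler's theorem follows from a weak form of Minkowski's
  second theorem, which reduces to packing cubes.\<close>

section \<open>Packing\<close>

text \<open>For \<gamma> = \<alpha> / (1 - \<alpha>) one has 1/\<gamma> + 1 = 1/\<alpha>. In terms
  of the critical rates s of the lattice and t of its dual, the claim is that s and t have opposite
  signs or both vanish, and that |t| lies between |s| / (d - 1) and (d - 1) |s|; an infinite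
  exponent is the rate 1. An ordinary exponent faces a uniform one because transference turns too
  few points for u into enough dual points for 1/u: if the lattice fails for all large u, the dual
  succeeds for all large 1/u. Constants are harmless, since rates are compared strictly and the
  spare positive power of |u| absorbs them. This permits Euclidean minima of a rescaled lattice, in
  which the box is a cube, and the crude constant n! n^n. The obstacle in transference is that
  vectors attaining the minima need not generate the lattice, so their dual basis may leave the dual
  lattice. Integral substitutes are built from cofactors; each cofactor row omits one minimum, which
  is why a bound on the product of all minima is required.\<close>

lemma finite_bounded_integer_vectors:
  "finite {z :: real ^ 'n. \<forall>i. z $ i \<in> \<int> \<and> \<bar>z $ i\<bar> \<le> c}"
proof -
  have "finite {x :: real. x \<in> \<int> \<and> \<bar>x\<bar> \<le> c}"
    by (rule finite_abs_int_segment)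
  then have "finite ((\<lambda>f. \<chi> i::'n. f i) ` (UNIV \<rightarrow>\<^sub>E {x :: real. x \<in> \<int> \<and> \<bar>x\<bar> \<le> c}))"
    by (intro finite_imageI finite_PiE) auto
  moreover have "{z :: real ^ 'n. \<forall>i. z $ i \<in> \<int> \<and> \<bar>z $ i\<bar> \<le> c}
      \<subseteq> (\<lambda>f. \<chi> i::'n. f i) ` (UNIV \<rightarrow>\<^sub>E {x :: real. x \<in> \<int> \<and> \<bar>x\<bar> \<le> c})"
  proof
    fix z :: "real ^ 'n"
    assume "z \<in> {z. \<forall>i. z $ i \<in> \<int> \<and> \<bar>z $ i\<bar> \<le> c}"
    then have "z = (\<chi> i. (\<lambda>i. z $ i) i)" "(\<lambda>i. z $ i) \<in> UNIV \<rightarrow>\<^sub>E {x. x \<in> \<int> \<and> \<bar>x\<bar> \<le> c}"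
      by auto
    then show "z \<in> (\<lambda>f. \<chi> i::'n. f i) ` (UNIV \<rightarrow>\<^sub>E {x :: real. x \<in> \<int> \<and> \<bar>x\<bar> \<le> c})"
      by blast
  qed
  ultimately show ?thesis by (rule finite_subset[rotated])
qed

lemma card_natural_vectors_lessThan:
  "card {z :: real ^ 'n. \<forall>i. z $ i \<in> real ` {..<N}} = N ^ CARD('n)"
proof -
  have eq: "{z :: real ^ 'n. \<forall>i. z $ i \<in> real ` {..<N}} =
      (\<lambda>f. \<chi> i::'n. f i) ` (UNIV \<rightarrow>\<^sub>E real ` {..<N})" (is "?L = ?R")
  proof
    show "?L \<subseteq> ?R"
    proof
      fix z :: "real ^ 'n" assume "z \<in> ?L"
      then have "z = (\<chi> i. (\<lambda>i. z $ i) i)" "(\<lambda>i. z $ i) \<in> UNIV \<rightarrow>\<^sub>E real ` {..<N}"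
        by auto
      then show "z \<in> ?R" by blast
    qed
  qed (auto simp: PiE_iff)
  have "inj_on (\<lambda>f. \<chi> i::'n. f i) (UNIV \<rightarrow>\<^sub>E real ` {..<N})"
    by (rule inj_onI) (simp add: vec_eq_iff fun_eq_iff)
  then show ?thesis
    unfolding eq by (simp add: card_image card_PiE)
qed

lemma ex_bound_matrix_vector_mult:
  fixes A :: "real ^ 'n ^ 'm"
  obtains c where "c > 0" "\<And>x. norm (A *v x) \<le> c * norm x"
  using bounded_linear.pos_bounded[OF matrix_vector_mul_bounded_linear[of A]]
  by (metis mult.commute)

text \<open>The library's change of variables for linear maps needs a well-ordered index type, so an
  arbitrary finite index type is replaced by a well-ordered copy.\<close>

typedef 'a wellordered_copy = "UNIV :: 'a set" by simp

instance wellordered_copy :: (finite) finite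
proof
  have "finite (Abs_wellordered_copy ` (UNIV :: 'a set))" by simp
  then show "finite (UNIV :: 'a wellordered_copy set)"
    by (simp add: type_definition.Abs_image[OF type_definition_wellordered_copy])
qed

definition copy_index :: "'a :: finite wellordered_copy \<Rightarrow> nat" where
  "copy_index = (SOME f. inj f)"

lemma inj_copy_index: "inj (copy_index :: 'a :: finite wellordered_copy \<Rightarrow> nat)"
proof -
  obtain f :: "'a wellordered_copy \<Rightarrow> nat" where "inj f"
    using finite_imp_inj_to_nat_seg[OF finite_class.finite_UNIV] by blast
  then show ?thesis unfolding copy_index_def by (rule someI[of inj])
qed

instantiation wellordered_copy :: (finite) linorder
begin

definition less_eq_wellordered_copy :: "'a wellordered_copy \<Rightarrow> 'a wellordered_copy \<Rightarrow> bool" where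
  "less_eq_wellordered_copy x y \<longleftrightarrow> copy_index x \<le> copy_index y"

definition less_wellordered_copy :: "'a wellordered_copy \<Rightarrow> 'a wellordered_copy \<Rightarrow> bool" where
  "less_wellordered_copy x y \<longleftrightarrow> copy_index x < copy_index y"

instance
proof
  fix x y z :: "'a wellordered_copy"
  show "x < y \<longleftrightarrow> x \<le> y \<and> \<not> y \<le> x" "x \<le> x" "x \<le> y \<or> y \<le> x"
    by (auto simp: less_eq_wellordered_copy_def less_wellordered_copy_def)
  show "x \<le> z" if "x \<le> y" "y \<le> z"
    using that by (simp add: less_eq_wellordered_copy_def)
  show "x = y" if "x \<le> y" "y \<le> x"
    by (rule injD[OF inj_copy_index]) (use that in \<open>simp add: less_eq_wellordered_copy_def\<close>)
qed

end

instance wellordered_copy :: (finite) wellorder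
proof
  fix P :: "'a wellordered_copy \<Rightarrow> bool" and a
  assume step: "\<And>x. (\<And>y. y < x \<Longrightarrow> P y) \<Longrightarrow> P x"
  show "P a"
  proof (induction a rule: measure_induct_rule[of copy_index])
    case (less x)
    then show ?case using step by (metis less_wellordered_copy_def)
  qed
qed

text \<open>Conjugation with the bijection matches the permutations of the two index types,
  preserves signs and only reorders the factors of each Leibniz term.\<close>

lemma det_reindex:
  fixes A :: "'a :: comm_ring_1 ^ 'n ^ 'n" and f :: "'m :: finite \<Rightarrow> 'n"
  assumes f: "bij f"
  shows "det (\<chi> i j. A $ f i $ f j) = det A"
proof -
  have bij: "bij_betw (map_permutation UNIV f) {p. p permutes UNIV} {p. p permutes UNIV}"
  proof (rule bij_betw_byWitness[where f' = "map_permutation UNIV (inv f)"])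
    show "\<forall>p\<in>{p. p permutes UNIV}. map_permutation UNIV (inv f) (map_permutation UNIV f p) = p"
      using map_permutation_compose_inv[OF f] f by (simp add: bij_is_inj)
    show "\<forall>p\<in>{p. p permutes UNIV}. map_permutation UNIV f (map_permutation UNIV (inv f) p) = p"
      using map_permutation_compose_inv[OF bij_imp_bij_inv[OF f]] f by (simp add: bij_is_surj surj_f_inv_f)
    show "map_permutation UNIV f ` {p. p permutes UNIV} \<subseteq> {p. p permutes UNIV}"
      using map_permutation_permutes[OF f] by blast
    show "map_permutation UNIV (inv f) ` {p. p permutes UNIV} \<subseteq> {p. p permutes UNIV}"
      using map_permutation_permutes[OF bij_imp_bij_inv[OF f]] by blast
  qed
  have inj: "inj f" using f by (simp add: bij_def)
  have "det A = (\<Sum>p | p permutes (UNIV :: 'm set).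
      of_int (sign (map_permutation UNIV f p)) * (\<Prod>i\<in>UNIV. A $ i $ map_permutation UNIV f p i))"
    unfolding det_def by (rule sum.reindex_bij_betw[OF bij, symmetric])
  also have "\<dots> = det (\<chi> i j. A $ f i $ f j)"
    unfolding det_def
  proof (rule sum.cong[OF refl])
    fix p :: "'m \<Rightarrow> 'm" assume p: "p \<in> {p. p permutes UNIV}"
    have "(\<Prod>i\<in>UNIV. A $ i $ map_permutation UNIV f p i) = (\<Prod>i\<in>UNIV. A $ f i $ map_permutation UNIV f p (f i))"
      by (rule prod.reindex_bij_betw[OF f, symmetric])
    then show "of_int (sign (map_permutation UNIV f p)) * (\<Prod>i\<in>UNIV. A $ i $ map_permutation UNIV f p i) =
        of_int (sign p) * (\<Prod>i\<in>UNIV. (\<chi> i j. A $ f i $ f j) $ i $ p i)"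
      using p inj by (simp add: sign_map_permutation map_permutation_apply)
  qed
  finally show ?thesis ..
qed

text \<open>Two integer points differ by a nonzero integer vector, so by \<open>far\<close> the open
  cubes of side \<open>s\<close> at the points \<open>E *v z\<close> are disjoint. Those with
  \<open>z\<close> in an integer cube of side \<open>N\<close> fit into the image of a slightly
  larger real cube; comparing volumes and letting \<open>N\<close> grow removes the boundary
  term.\<close>

lemma packing_det_wellordered:
  fixes E :: "real ^ ('n :: {finite, wellorder}) ^ ('n :: {finite, wellorder})"
  assumes inv: "invertible E" and s: "s > 0"
    and far: "\<And>z. (\<And>i. z $ i \<in> \<int>) \<Longrightarrow> z \<noteq> 0 \<Longrightarrow> \<exists>i. \<bar>(E *v z) $ i\<bar> \<ge> s"
  shows "s ^ CARD('n) \<le> \<bar>det E\<bar>"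
proof -
  define K where "K z = box (E *v z) (E *v z + s *\<^sub>R 1)" for z :: "real ^ 'n :: _"
  obtain E' where E': "E ** E' = mat 1" "E' ** E = mat 1"
    using inv unfolding invertible_def by blast
  obtain c0 where c0: "c0 > 0" "\<And>x. norm (E' *v x) \<le> c0 * norm x"
    using ex_bound_matrix_vector_mult by blast
  \<comment> \<open>A vector with entries at most \<open>s\<close> has norm at most n * s, so its
    preimage under \<open>E\<close> has entries at most \<open>c\<close>: the width of the collar to
    be added.\<close>
  define c where "c = c0 * (CARD('n) * s)"
  have c: "c > 0" using c0 s by (simp add: c_def)
  have measK: "measure lebesgue (K z) = s ^ CARD('n)" for z
  proof -
    have "measure lebesgue (K z) = measure lborel (K z)"
      by (simp add: K_def)
    also have "\<dots> = measure lborel (cbox (E *v z) (E *v z + s *\<^sub>R 1))"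
      by (simp add: K_def measure_lborel_box_eq measure_lborel_cbox_eq)
    also have "\<dots> = s ^ CARD('n)"
      using s by (subst content_cbox_cart) (auto simp: interval_ne_empty_cart less_imp_le)
    finally show ?thesis .
  qed
  have bound: "real N ^ CARD('n) * s ^ CARD('n) \<le> \<bar>det E\<bar> * (real N + 2 * c) ^ CARD('n)" for N :: nat
  proof -
    define Z where "Z = {z :: real ^ 'n :: _. \<forall>i. z $ i \<in> real ` {..<N}}"
    have cardZ: "card Z = N ^ CARD('n)"
      unfolding Z_def by (rule card_natural_vectors_lessThan)
    have finZ: "finite Z"
    proof (rule finite_subset[OF _ finite_bounded_integer_vectors[of "real N"]], safe)
      fix z i assume "z \<in> Z"
      then have "z $ i \<in> real ` {..<N}" by (auto simp: Z_def)
      then show "z $ i \<in> \<int>" "\<bar>z $ i\<bar> \<le> real N" by auto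
    qed
    have disj: "disjoint_family_on K Z"
      unfolding disjoint_family_on_def
    proof (intro ballI impI)
      fix y z assume yz: "y \<in> Z" "z \<in> Z" "y \<noteq> z"
      have "(y - z) $ i \<in> \<int>" for i
      proof -
        have "y $ i \<in> real ` {..<N}" "z $ i \<in> real ` {..<N}" using yz by (auto simp: Z_def)
        then show ?thesis by auto
      qed
      then obtain i where i: "\<bar>(E *v (y - z)) $ i\<bar> \<ge> s"
        using far yz(3) by (metis right_minus_eq)
      show "K y \<inter> K z = {}"
      proof (rule ccontr)
        assume "K y \<inter> K z \<noteq> {}"
        then obtain x where "x \<in> K y" "x \<in> K z" by blast
        then have "(E *v y) $ i < x $ i" "x $ i < (E *v y) $ i + s"
          "(E *v z) $ i < x $ i" "x $ i < (E *v z) $ i + s"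
          unfolding K_def mem_box_cart by (auto dest!: spec[of _ i])
        then show False
          using i by (simp add: matrix_vector_mult_diff_distrib)
      qed
    qed
    have "real (card Z) * s ^ CARD('n) = (\<Sum>z\<in>Z. measure lebesgue (K z))"
      by (simp add: measK)
    also have "\<dots> = measure lebesgue (\<Union>z\<in>Z. K z)"
    proof (rule measure_finite_Union[symmetric, OF finZ _ disj])
      show "K ` Z \<subseteq> sets lebesgue" by (auto simp: K_def)
      show "emeasure lebesgue (K z) \<noteq> \<infinity>" if "z \<in> Z" for z
        by (simp add: K_def emeasure_lborel_box_eq)
    qed
    also have "\<dots> \<le> measure lebesgue ((*v) E ` cbox ((- c) *\<^sub>R 1) ((real N + c) *\<^sub>R 1))"
    proof (rule measure_mono_fmeasurable)
      show "(\<Union>z\<in>Z. K z) \<subseteq> (*v) E ` cbox ((- c) *\<^sub>R 1) ((real N + c) *\<^sub>R 1)"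
      proof
        fix x assume "x \<in> (\<Union>z\<in>Z. K z)"
        then obtain z where z: "z \<in> Z" "x \<in> K z" by blast
        define y where "y = x - E *v z"
        have "\<bar>y $ i\<bar> \<le> s" for i
          using z(2) unfolding K_def mem_box_cart y_def by (auto dest!: spec[of _ i])
        then have "norm y \<le> CARD('n) * s"
          by (intro order.trans[OF norm_le_l1_cart]) (rule sum_bounded_above[where A = UNIV, simplified], auto)
        then have "norm (E' *v y) \<le> c"
          unfolding c_def using c0 by (meson order.trans mult_left_mono less_imp_le)
        then have yc: "\<bar>(E' *v y) $ i\<bar> \<le> c" for i
          using component_le_norm_cart order.trans by blast
        have "x = E *v (z + E' *v y)"
          by (simp add: y_def matrix_vector_right_distrib matrix_vector_mul_assoc E')
        moreover have "z + E' *v y \<in> cbox ((- c) *\<^sub>R 1) ((real N + c) *\<^sub>R 1)"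
          unfolding mem_box_cart
        proof
          fix i
          have "z $ i \<in> real ` {..<N}" using z by (auto simp: Z_def)
          then have "0 \<le> z $ i" "z $ i \<le> real N" by auto
          then show "((- c) *\<^sub>R 1) $ i \<le> (z + E' *v y) $ i \<and> (z + E' *v y) $ i \<le> ((real N + c) *\<^sub>R 1) $ i"
            using yc[of i] by (simp add: abs_le_iff)
        qed
        ultimately show "x \<in> (*v) E ` cbox ((- c) *\<^sub>R 1) ((real N + c) *\<^sub>R 1)" by blast
      qed
      show "(\<Union>z\<in>Z. K z) \<in> sets lebesgue"
        using finZ by (intro sets.finite_UN) (auto simp: K_def)
      show "(*v) E ` cbox ((- c) *\<^sub>R 1) ((real N + c) *\<^sub>R 1) \<in> lmeasurable"
        by (rule measurable_linear_image_interval[OF matrix_vector_mul_linear])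
    qed
    also have "\<dots> = \<bar>det E\<bar> * measure lborel (cbox ((- c) *\<^sub>R 1 :: real ^ 'n :: _) ((real N + c) *\<^sub>R 1))"
      by (subst measure_linear_image) (auto simp: matrix_of_matrix_vector_mul)
    also have "measure lborel (cbox ((- c) *\<^sub>R 1 :: real ^ 'n :: _) ((real N + c) *\<^sub>R 1)) = (real N + 2 * c) ^ CARD('n)"
      using c by (subst content_cbox_cart) (auto simp: interval_ne_empty_cart algebra_simps)
    finally show ?thesis by (simp add: cardZ)
  qed
  \<comment> \<open>After division by N^n the collar contributes a factor tending to 1.\<close>
  have "(\<lambda>N. 2 * c / real N) \<longlonglongrightarrow> 0"
    by (rule lim_const_over_n)
  then have "(\<lambda>N. \<bar>det E\<bar> * (1 + 2 * c / real N) ^ CARD('n)) \<longlonglongrightarrow> \<bar>det E\<bar> * (1 + 0) ^ CARD('n)"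
    by (intro tendsto_intros)
  moreover have "\<forall>N\<ge>1. s ^ CARD('n) \<le> \<bar>det E\<bar> * (1 + 2 * c / real N) ^ CARD('n)"
  proof (intro allI impI)
    fix N :: nat assume N: "N \<ge> 1"
    have "real N + 2 * c = real N * (1 + 2 * c / real N)" using N by (simp add: field_simps)
    then have "real N ^ CARD('n) * s ^ CARD('n) \<le> real N ^ CARD('n) * (\<bar>det E\<bar> * (1 + 2 * c / real N) ^ CARD('n))"
      using bound[of N] by (metis power_mult_distrib mult.left_commute)
    then show "s ^ CARD('n) \<le> \<bar>det E\<bar> * (1 + 2 * c / real N) ^ CARD('n)"
      using N by (simp add: mult_le_cancel_left_pos)
  qed
  ultimately show ?thesis
    using LIMSEQ_le_const by fastforce
qed

lemma packing_det:
  fixes E :: "real ^ 'n ^ 'n"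
  assumes inv: "invertible E" and s: "s > 0"
    and far: "\<And>z. (\<And>i. z $ i \<in> \<int>) \<Longrightarrow> z \<noteq> 0 \<Longrightarrow> \<exists>i. \<bar>(E *v z) $ i\<bar> \<ge> s"
  shows "s ^ CARD('n) \<le> \<bar>det E\<bar>"
proof -
  define r where "r = (Rep_wellordered_copy :: 'n wellordered_copy \<Rightarrow> 'n)"
  have r: "bij r" unfolding r_def
    by (metis Abs_wellordered_copy_inverse Rep_wellordered_copy_inject UNIV_I bijI')
  define E' :: "real ^ 'n wellordered_copy ^ 'n wellordered_copy" where "E' = (\<chi> i j. E $ r i $ r j)"
  have det: "det E' = det E" unfolding E'_def by (rule det_reindex[OF r])
  have "s ^ CARD('n wellordered_copy) \<le> \<bar>det E'\<bar>"
  proof (rule packing_det_wellordered[OF _ s])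
    show "invertible E'" using inv by (simp add: invertible_det_nz det)
    fix z' :: "real ^ 'n wellordered_copy"
    assume z': "\<And>i. z' $ i \<in> \<int>" "z' \<noteq> 0"
    define z where "z = (\<chi> i. z' $ inv r i)"
    have z'z: "z' $ i = z $ r i" for i
      using r by (simp add: z_def bij_is_inj)
    have "z \<noteq> 0" using z'(2) z'z by (auto simp: vec_eq_iff)
    moreover have "z $ i \<in> \<int>" for i by (simp add: z_def z')
    ultimately obtain i where i: "\<bar>(E *v z) $ i\<bar> \<ge> s" using far by blast
    have "(E' *v z') $ inv r i = (\<Sum>j\<in>UNIV. E $ i $ r j * z $ r j)"
      using r by (simp add: matrix_vector_mult_def E'_def z'z bij_is_surj surj_f_inv_f)
    also have "\<dots> = (E *v z) $ i"
      unfolding matrix_vector_mult_def vec_lambda_beta by (rule sum.reindex_bij_betw[OF r])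
    finally show "\<exists>i. \<bar>(E' *v z') $ i\<bar> \<ge> s" using i by metis
  qed
  moreover have "CARD('n wellordered_copy) = CARD('n)"
    using r by (rule bij_betw_same_card)
  ultimately show ?thesis by (simp add: det)
qed

section \<open>Successive minima\<close>

text \<open>The columns of \<open>G\<close> lie in \<open>M\<close> and span the space, so some
  lattice vector avoids \<open>span S\<close>. Only finitely many are no longer than it, because
  \<open>G'\<close> bounds their integer coordinates, hence a shortest one exists.\<close>

lemma minimal_lattice_vector:
  fixes G :: "real ^ 'n ^ 'n"
  assumes inv: "invertible G" and M: "M = {G *v z | z. \<forall>i. z $ i \<in> \<int>}" and S: "span S \<noteq> UNIV"
  obtains x where "x \<in> M" "x \<notin> span S" "\<And>y. y \<in> M \<Longrightarrow> y \<notin> span S \<Longrightarrow> norm x \<le> norm y"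
proof -
  obtain G' where G': "G ** G' = mat 1" "G' ** G = mat 1"
    using inv unfolding invertible_def by blast
  obtain c where c: "c > 0" "\<And>x. norm (G' *v x) \<le> c * norm x"
    using ex_bound_matrix_vector_mult by blast
  have col: "column i G \<in> M" for i
    unfolding M mem_Collect_eq using matrix_vector_mult_basis[of G i]
    by (intro exI[of _ "axis i 1"]) (simp add: axis_def)
  have "\<not> M \<subseteq> span S"
  proof
    assume "M \<subseteq> span S"
    have "x \<in> span S" for x
    proof -
      have "x = G *v (G' *v x)" by (simp add: matrix_vector_mul_assoc G')
      also have "\<dots> = (\<Sum>i\<in>UNIV. (G' *v x) $ i *\<^sub>R column i G)"
        by (subst matrix_mult_sum) (simp add: scalar_mult_eq_scaleR)
      also have "\<dots> \<in> span S"
        using col \<open>M \<subseteq> span S\<close> by (intro span_sum span_scale) auto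
      finally show ?thesis .
    qed
    then show False using S by auto
  qed
  then obtain x0 where x0: "x0 \<in> M" "x0 \<notin> span S" by auto
  define F where "F = {x \<in> M - span S. norm x \<le> norm x0}"
  have "F \<subseteq> (*v) G ` {z. \<forall>i. z $ i \<in> \<int> \<and> \<bar>z $ i\<bar> \<le> c * norm x0}"
  proof
    fix x assume "x \<in> F"
    then obtain z where z: "x = G *v z" "\<forall>i. z $ i \<in> \<int>" and le: "norm x \<le> norm x0"
      unfolding F_def M by blast
    have "z = G' *v x" by (simp add: z matrix_vector_mul_assoc G')
    then have "norm z \<le> c * norm x0"
      using c le by (meson order.trans mult_left_mono less_imp_le)
    then have "\<bar>z $ i\<bar> \<le> c * norm x0" for i
      using component_le_norm_cart order.trans by blast
    then show "x \<in> (*v) G ` {z. \<forall>i. z $ i \<in> \<int> \<and> \<bar>z $ i\<bar> \<le> c * norm x0}"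
      using z by blast
  qed
  then have "finite F"
    using finite_bounded_integer_vectors finite_surj by blast
  moreover have "x0 \<in> F" using x0 by (simp add: F_def)
  ultimately have "Min (norm ` F) \<in> norm ` F" and Min: "\<And>y. y \<in> F \<Longrightarrow> Min (norm ` F) \<le> norm y"
    by (auto intro!: Min_in)
  then obtain x where x: "x \<in> F" "\<And>y. y \<in> F \<Longrightarrow> norm x \<le> norm y"
    by force
  show ?thesis
  proof
    show "x \<in> M" "x \<notin> span S" using x by (auto simp: F_def)
    show "norm x \<le> norm y" if "y \<in> M" "y \<notin> span S" for y
      using x(2)[of y] x(1) that by (cases "norm y \<le> norm x0") (auto simp: F_def)
  qed
qed

text \<open>The numbers \<open>norm (b i)\<close> are the successive minima for the Euclidean ball,
  chosen greedily and counted from 0, so the k-th minimum has index k - 1. The vectors are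
  independent but need not generate \<open>M\<close>.\<close>

definition attains_minima :: "(real ^ 'n) set \<Rightarrow> nat \<Rightarrow> (nat \<Rightarrow> real ^ 'n) \<Rightarrow> bool" where
  "attains_minima M m b \<longleftrightarrow> (\<forall>i<m. b i \<in> M \<and> b i \<notin> span (b ` {..<i}) \<and>
     (\<forall>x\<in>M. x \<notin> span (b ` {..<i}) \<longrightarrow> norm (b i) \<le> norm x))"

lemma ex_attains_minima:
  fixes G :: "real ^ 'n ^ 'n"
  assumes inv: "invertible G" and M: "M = {G *v z | z. \<forall>i. z $ i \<in> \<int>}" and "m \<le> CARD('n)"
  shows "\<exists>b. attains_minima M m b"
  using assms(3)
proof (induction m)
  case 0
  then show ?case by (simp add: attains_minima_def)
next
  case (Suc m)
  then obtain b where b: "attains_minima M m b" by auto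
  have "dim (b ` {..<m}) \<le> card (b ` {..<m})"
    by (simp add: dim_le_card')
  also have "\<dots> \<le> m" using card_image_le[of "{..<m}" b] by simp
  finally have "dim (b ` {..<m}) < DIM(real ^ 'n)" using Suc.prems by simp
  then have "span (b ` {..<m}) \<noteq> UNIV"
    using dim_eq_full by (metis less_irrefl)
  then obtain x where x: "x \<in> M" "x \<notin> span (b ` {..<m})"
      "\<And>y. y \<in> M \<Longrightarrow> y \<notin> span (b ` {..<m}) \<Longrightarrow> norm x \<le> norm y"
    using minimal_lattice_vector[OF inv M] by blast
  have im: "(b(m := x)) ` {..<i} = b ` {..<i}" if "i \<le> m" for i
    using that by (intro image_cong) auto
  have "attains_minima M (Suc m) (b(m := x))"
    unfolding attains_minima_def
  proof (intro allI impI)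
    fix i assume "i < Suc m"
    then consider "i < m" | "i = m" by linarith
    then show "(b(m := x)) i \<in> M \<and> (b(m := x)) i \<notin> span ((b(m := x)) ` {..<i}) \<and>
      (\<forall>y\<in>M. y \<notin> span ((b(m := x)) ` {..<i}) \<longrightarrow> norm ((b(m := x)) i) \<le> norm y)"
    proof cases
      case 1
      then show ?thesis using b by (simp add: attains_minima_def im)
    next
      case 2
      then show ?thesis using x im[of m] by auto
    qed
  qed
  then show ?case by blast
qed

text \<open>A vector outside the later, larger span was already a competitor at the earlier
  choice.\<close>

lemma attains_minima_norm_mono:
  assumes "attains_minima M m b" "i \<le> j" "j < m"
  shows "norm (b i) \<le> norm (b j)"
proof -
  have "span (b ` {..<i}) \<subseteq> span (b ` {..<j})"
    using assms(2) by (intro span_mono image_mono) auto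
  then show ?thesis using assms unfolding attains_minima_def
    by (meson le_less_trans subsetD)
qed

lemma attains_minima_independent:
  assumes "attains_minima M m b" "l \<le> m"
  shows "independent (b ` {..<l}) \<and> card (b ` {..<l}) = l"
  using assms(2)
proof (induction l)
  case 0
  then show ?case by (simp add: independent_empty)
next
  case (Suc l)
  have "b l \<notin> span (b ` {..<l})"
    using assms(1) Suc.prems unfolding attains_minima_def by auto
  moreover from this have "b l \<notin> b ` {..<l}" by (rule contrapos_nn) (rule span_base)
  ultimately show ?case
    using Suc by (simp add: lessThan_Suc independent_insert)
qed

text \<open>In the orthonormal basis obtained from the minimal vectors by Gram--Schmidt, dividing the
  \<open>i\<close>-th coordinate by the \<open>i\<close>-th minimum produces a lattice without short vectors.\<close>

lemma prod_minima_le_det: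
  fixes G :: "real ^ 'n ^ 'n"
  assumes inv: "invertible G" and M: "M = {G *v z | z. \<forall>i. z $ i \<in> \<int>}"
    and b: "attains_minima M CARD('n) b"
  shows "(\<Prod>i<CARD('n). norm (b i)) \<le> real CARD('n) ^ CARD('n) * \<bar>det G\<bar>"
proof -
  let ?n = "CARD('n)"
  obtain e :: "'n \<Rightarrow> nat" where e: "bij_betw e UNIV {..<?n}"
    using ex_bij_betw_finite_nat[of "UNIV :: 'n set"] by (auto simp: atLeast0LessThan)
  have en: "e i < ?n" for i using e by (auto simp: bij_betw_def)
  have inje: "e i = e j \<longleftrightarrow> i = j" for i j using e by (auto simp: bij_betw_def inj_on_def)
  have notin: "b i \<notin> span (b ` {..<i})" if "i < ?n" for i
    using b that unfolding attains_minima_def by blast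
  have pos: "norm (b i) > 0" if "i < ?n" for i
    using notin[OF that] span_zero by (metis zero_less_norm_iff)
  \<comment> \<open>Gram-Schmidt, one vector at a time: each span is properly contained in the next,
    which therefore contains a unit vector orthogonal to it.\<close>
  have "\<exists>g. norm g = 1 \<and> g \<in> span (b ` {..<Suc i}) \<and> (\<forall>x\<in>span (b ` {..<i}). g \<bullet> x = 0)"
    if "i < ?n" for i
  proof -
    have "span (b ` {..<i}) \<subset> span (b ` {..<Suc i})"
    proof
      show "span (b ` {..<i}) \<subseteq> span (b ` {..<Suc i})" by (intro span_mono image_mono) auto
      show "span (b ` {..<i}) \<noteq> span (b ` {..<Suc i})"
        using notin[OF that] span_base[of "b i" "b ` {..<Suc i}"] by auto
    qed
    then obtain x where x: "x \<noteq> 0" "x \<in> span (b ` {..<Suc i})"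
        "\<And>y. y \<in> span (b ` {..<i}) \<Longrightarrow> orthogonal x y"
      using orthogonal_to_subspace_exists_gen by metis
    then show ?thesis
      by (intro exI[of _ "(1 / norm x) *\<^sub>R x"]) (auto simp: orthogonal_def intro: span_scale)
  qed
  then obtain g where g: "\<And>i. i < ?n \<Longrightarrow> norm (g i) = 1"
      "\<And>i. i < ?n \<Longrightarrow> g i \<in> span (b ` {..<Suc i})"
      "\<And>i x. i < ?n \<Longrightarrow> x \<in> span (b ` {..<i}) \<Longrightarrow> g i \<bullet> x = 0"
    by metis
  have g0: "g i \<bullet> x = 0" if "i < ?n" "j < i" "x \<in> span (b ` {..<Suc j})" for i j x
  proof -
    have "span (b ` {..<Suc j}) \<subseteq> span (b ` {..<i})"
      using that by (intro span_mono image_mono) auto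
    then show ?thesis using g(3) that by blast
  qed
  define Q :: "real ^ 'n ^ 'n" where "Q = (\<chi> i. g (e i))"
  have Q: "orthogonal_matrix Q"
    unfolding orthogonal_matrix_orthonormal_rows
  proof (intro conjI allI impI)
    show "norm (row i Q) = 1" for i
      using g(1)[OF en] by (simp add: Q_def row_def)
    fix i j :: 'n assume "i \<noteq> j"
    then have "e i < e j \<or> e j < e i" using inje by (metis linorder_neqE_nat)
    then have "g (e i) \<bullet> g (e j) = 0"
      using g0[of "e i" "e j" "g (e j)"] g0[of "e j" "e i" "g (e i)"] g(2) en by (metis inner_commute)
    then show "orthogonal (row i Q) (row j Q)"
      by (simp add: Q_def row_def orthogonal_def)
  qed
  then have normQ: "norm (Q *v x) = norm x" for x
    using orthogonal_transformation_matrix[of "(*v) Q"]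
    by (simp add: orthogonal_transformation_norm matrix_of_matrix_vector_mul)
  \<comment> \<open>\<open>E\<close> takes coordinates in the orthonormal basis \<open>g\<close> and
    divides each by the minimum of the same index, so its determinant is, up to sign,
    \<open>det G\<close> over the product of the minima.\<close>
  define E :: "real ^ 'n ^ 'n" where "E = (\<chi> i. (1 / norm (b (e i))) *s ((Q ** G) $ i))"
  have compE: "(E *v z) $ i = (g (e i) \<bullet> (G *v z)) / norm (b (e i))" for z i
  proof -
    have "(E *v z) $ i = (E $ i) \<bullet> z" by (rule matrix_vector_mul_component)
    also have "\<dots> = (1 / norm (b (e i))) * (((Q ** G) $ i) \<bullet> z)"
      by (simp add: E_def scalar_mult_eq_scaleR)
    also have "((Q ** G) $ i) \<bullet> z = ((Q ** G) *v z) $ i"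
      by (simp add: matrix_vector_mul_component)
    also have "\<dots> = (Q *v (G *v z)) $ i" by (simp add: matrix_vector_mul_assoc)
    also have "\<dots> = g (e i) \<bullet> (G *v z)"
      by (simp add: matrix_vector_mul_component Q_def)
    finally show ?thesis by simp
  qed
  have detQ: "\<bar>det Q\<bar> = 1" using det_orthogonal_matrix[OF Q] by auto
  have prod_e: "(\<Prod>i\<in>UNIV. norm (b (e i))) = (\<Prod>i<?n. norm (b i))"
    by (rule prod.reindex_bij_betw[OF e])
  have prod_pos: "(\<Prod>i<?n. norm (b i)) > 0"
    using pos by (intro prod_pos) auto
  have "det E = (\<Prod>i\<in>UNIV. 1 / norm (b (e i))) * det (Q ** G)"
    unfolding E_def by (subst det_rows_mul) simp
  also have "\<dots> = det Q * det G / (\<Prod>i<?n. norm (b i))"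
    unfolding prod_e[symmetric] by (simp add: prod_dividef det_mul)
  finally have detE: "det E = det Q * det G / (\<Prod>i<?n. norm (b i))" .
  \<comment> \<open>The side is 1/n because n coordinates, each below a 1/n share of
    \<open>norm (b j)\<close>, are finally added up. This is the origin of the factor n^n.\<close>
  have "(1 / real ?n) ^ ?n \<le> \<bar>det E\<bar>"
  proof (rule packing_det)
    show "invertible E"
      using inv detQ pos unfolding invertible_det_nz detE by fastforce
    fix z :: "real ^ 'n"
    assume z: "\<And>i. z $ i \<in> \<int>" "z \<noteq> 0"
    define x where "x = G *v z"
    have xM: "x \<in> M" using z M x_def by blast
    have x0: "x \<noteq> 0"
      using inv z(2) unfolding x_def invertible_def
      by (metis matrix_vector_mul_assoc matrix_vector_mul_lid matrix_vector_mult_0_right)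
    have "span (b ` {..<?n}) = UNIV"
      using attains_minima_independent[OF b order.refl]
      by (metis DIM_cart DIM_real dim_eq_full dim_eq_card_independent mult.right_neutral)
    then have "x \<in> span (b ` {..<?n})" by simp
    moreover have "x \<notin> span (b ` {..<0})" using x0 by simp
    \<comment> \<open>\<open>x\<close> enters the flag of spans exactly at \<open>b j\<close>:
      minimality of \<open>b j\<close> applies to it, its coordinates along later \<open>g i\<close>
      vanish, and the earlier ones were divided by at most \<open>norm (b j)\<close>.\<close>
    ultimately obtain j where j: "j < ?n" "x \<in> span (b ` {..<Suc j})" "x \<notin> span (b ` {..<j})"
      using ex_least_nat_less[of "\<lambda>j. x \<in> span (b ` {..<j})" ?n] by (auto simp: lessThan_def)
    have le: "norm (b j) \<le> norm x"
      using b j xM unfolding attains_minima_def by blast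
    show "\<exists>i. \<bar>(E *v z) $ i\<bar> \<ge> 1 / real ?n"
    proof (rule ccontr)
      assume "\<not> ?thesis"
      then have small: "\<bar>(E *v z) $ i\<bar> < 1 / real ?n" for i by (simp add: not_le)
      have "\<bar>g (e i) \<bullet> x\<bar> < norm (b j) / real ?n" for i
      proof (cases "e i \<le> j")
        case True
        have "\<bar>g (e i) \<bullet> x\<bar> < norm (b (e i)) / real ?n"
          using small[of i] pos[OF en[of i]] unfolding compE x_def[symmetric]
          by (simp add: field_simps abs_div)
        also have "\<dots> \<le> norm (b j) / real ?n"
          using attains_minima_norm_mono[OF b True j(1)] by (simp add: divide_right_mono)
        finally show ?thesis .
      next
        case False
        then show ?thesis using g0[OF en[of i] _ j(2)] pos[OF j(1)] by simp
      qed
      then have lt: "\<bar>(Q *v x) $ i\<bar> < norm (b j) / real ?n" for i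
        by (simp add: matrix_vector_mul_component Q_def)
      have "norm x \<le> (\<Sum>i\<in>UNIV. \<bar>(Q *v x) $ i\<bar>)"
        using norm_le_l1_cart[of "Q *v x"] normQ by simp
      also have "\<dots> < (\<Sum>i\<in>(UNIV::'n set). norm (b j) / real ?n)"
        using lt by (intro sum_strict_mono) auto
      also have "\<dots> = norm (b j)" by simp
      finally show False using le by simp
    qed
  qed simp
  also have "\<bar>det E\<bar> = \<bar>det G\<bar> / (\<Prod>i<?n. norm (b i))"
    using prod_pos by (simp add: detE abs_mult detQ)
  finally show ?thesis
    using prod_pos by (simp add: field_simps)
qed

section \<open>Transference\<close>

text \<open>The Leibniz sum has n! terms, each at most the product of the row bounds.\<close>

lemma abs_det_le:
  fixes A :: "real ^ 'n ^ 'n"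
  assumes "\<And>i j. \<bar>A $ i $ j\<bar> \<le> c i"
  shows "\<bar>det A\<bar> \<le> fact CARD('n) * (\<Prod>i\<in>UNIV. c i)"
proof -
  have "\<bar>det A\<bar> \<le> (\<Sum>p | p permutes (UNIV :: 'n set). \<bar>of_int (sign p) * (\<Prod>i\<in>UNIV. A $ i $ p i)\<bar>)"
    unfolding det_def by (rule sum_abs)
  also have "\<dots> \<le> (\<Sum>p | p permutes (UNIV :: 'n set). \<Prod>i\<in>UNIV. c i)"
  proof (rule sum_mono)
    fix p :: "'n \<Rightarrow> 'n"
    have "\<bar>of_int (sign p) * (\<Prod>i\<in>UNIV. A $ i $ p i)\<bar> = (\<Prod>i\<in>UNIV. \<bar>A $ i $ p i\<bar>)"
      by (simp add: abs_mult sign_def abs_prod)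
    also have "\<dots> \<le> (\<Prod>i\<in>UNIV. c i)"
      using assms by (intro prod_mono) auto
    finally show "\<bar>of_int (sign p) * (\<Prod>i\<in>UNIV. A $ i $ p i)\<bar> \<le> (\<Prod>i\<in>UNIV. c i)" .
  qed
  also have "\<dots> = fact CARD('n) * (\<Prod>i\<in>UNIV. c i)"
    by (simp add: card_permutations[OF refl])
  finally show ?thesis .
qed

text \<open>The vector on the left is the i-th row of cofactors of \<open>P\<close>; the determinant
  is linear in its i-th row, so expanding that row in the standard basis gives the pairing.\<close>

lemma det_replace_row_linear:
  fixes P :: "real ^ 'n ^ 'n"
  shows "(\<chi> m. det (\<chi> r. if r = i then axis m 1 else P $ r)) \<bullet> x = det (\<chi> r. if r = i then x else P $ r)"
proof -
  have "det (\<chi> r. if r = i then x else P $ r) =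
      det (\<chi> r. if r = i then (\<Sum>m\<in>UNIV. x $ m *s axis m 1) else P $ r)"
    unfolding basis_expansion ..
  also have "\<dots> = (\<Sum>m\<in>UNIV. det (\<chi> r. if r = i then x $ m *s axis m 1 else P $ r))"
    by (rule det_linear_row_sum[OF finite])
  also have "\<dots> = (\<Sum>m\<in>UNIV. x $ m * det (\<chi> r. if r = i then axis m 1 else P $ r))"
    by (subst det_row_mul) simp
  finally show ?thesis
    by (simp add: inner_vec_def mult.commute)
qed

text \<open>The dual vectors are the cofactor rows of the matrix of minimal vectors, divided by
  \<open>det G\<close> rather than by the determinant of that matrix: this keeps them in the dual lattice.\<close>

lemma dual_vectors_of_minima:
  fixes G :: "real ^ 'n ^ 'n"
  assumes inv: "invertible G" and M: "M = {G *v z | z. \<forall>i. z $ i \<in> \<int>}"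
    and b: "attains_minima M CARD('n) b"
  shows "\<exists>q w. q \<noteq> 0 \<and> (\<forall>i<CARD('n). w i \<in> dual_lattice M) \<and>
    (\<forall>i<CARD('n). \<forall>j<CARD('n). w i \<bullet> b j = (if i = j then q else 0)) \<and>
    (\<forall>i<CARD('n). \<forall>m. \<bar>w i $ m\<bar> * norm (b i) \<le> fact CARD('n) * real CARD('n) ^ CARD('n))"
proof -
  let ?n = "CARD('n)"
  obtain e :: "'n \<Rightarrow> nat" where e: "bij_betw e UNIV {..<?n}"
    using ex_bij_betw_finite_nat[of "UNIV :: 'n set"] by (auto simp: atLeast0LessThan)
  define f where "f = the_inv_into UNIV e"
  have ef: "e (f i) = i" if "i < ?n" for i
    using e that unfolding f_def bij_betw_def by (intro f_the_inv_into_f) auto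
  have fe: "f (e i) = i" for i
    using e unfolding f_def bij_betw_def by (intro the_inv_into_f_f) auto
  have en: "e i < ?n" for i using e by (auto simp: bij_betw_def)
  have detG: "det G \<noteq> 0" using inv by (simp add: invertible_det_nz)
  have bM: "b i \<in> M" if "i < ?n" for i using b that unfolding attains_minima_def by blast
  have pos: "norm (b i) > 0" if "i < ?n" for i
    using b that span_zero unfolding attains_minima_def by (metis zero_less_norm_iff)
  define P :: "real ^ 'n ^ 'n" where "P = (\<chi> r. b (e r))"
  define w where "w i = (1 / det G) *\<^sub>R (\<chi> m. det (\<chi> r. if r = f i then axis m 1 else P $ r))" for i
  have w: "w i \<bullet> x = det (\<chi> r. if r = f i then x else P $ r) / det G" for i x
    unfolding w_def by (simp add: det_replace_row_linear)
  have "\<forall>r. \<exists>z. (\<forall>i. z $ i \<in> \<int>) \<and> b (e r) = G *v z"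
    using bM en M by blast
  then obtain zr where zr: "\<And>r i. zr r $ i \<in> \<int>" "\<And>r. b (e r) = G *v zr r" by metis
  have "rows P = b ` range e"
    by (auto simp: rows_def row_def P_def)
  then have "rows P = b ` {..<?n}"
    using e by (simp add: bij_betw_def)
  then have ind: "independent (rows P)" "card (rows P) = ?n"
    using attains_minima_independent[OF b order.refl] by auto
  have detP: "det P \<noteq> 0"
  proof
    assume "det P = 0"
    then have "rank P < ?n" by (simp add: det_eq_0_rank)
    moreover have "rank P = card (rows P)"
      using ind(1) by (simp add: row_rank_def dim_eq_card_independent)
    ultimately show False using ind by simp
  qed
  show ?thesis
  \<comment> \<open>Up to sign, the first witness is the index in \<open>M\<close> of the sublattice
    generated by the minimal vectors.\<close>
  proof (intro exI[of _ "det P / det G"] exI[of _ w] conjI allI impI)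
    show "det P / det G \<noteq> 0" using detP detG by simp
    show "w i \<in> dual_lattice M" if "i < ?n" for i
      unfolding dual_lattice_def
    proof (intro CollectI ballI)
      fix x assume "x \<in> M"
      then obtain z where z: "\<And>i. z $ i \<in> \<int>" "x = G *v z" unfolding M by blast
      define Z where "Z = (\<chi> r. if r = f i then z else zr r)"
      \<comment> \<open>All rows are lattice vectors, so splitting off \<open>G\<close> leaves the
        integer matrix \<open>Z\<close>.\<close>
      have "(\<chi> r. if r = f i then x else P $ r) = Z ** transpose G"
        by (auto simp: vec_eq_iff Z_def P_def zr z(2) matrix_matrix_mult_def matrix_vector_mult_def
            transpose_def mult.commute)
      then have "w i \<bullet> x = det Z" using detG by (simp add: w det_mul)
      moreover have "det Z \<in> \<int>"
        by (rule det_integer_entries) (simp add: Z_def z zr)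
      ultimately show "w i \<bullet> x \<in> \<int>" by simp
    qed
    show "w i \<bullet> b j = (if i = j then det P / det G else 0)" if "i < ?n" "j < ?n" for i j
    proof (cases "i = j")
      case True
      have "(\<chi> r. if r = f i then b j else P $ r) = P"
        using True ef[OF that(1)] by (auto simp: vec_eq_iff P_def)
      then show ?thesis using True by (simp add: w)
    next
      case False
      then have ne: "f j \<noteq> f i" using ef that by metis
      have "det (\<chi> r. if r = f i then b j else P $ r) = 0"
        by (rule det_identical_rows[OF ne])
          (use ne ef[OF that(2)] in \<open>auto simp: row_def vec_eq_iff P_def\<close>)
      then show ?thesis using False by (simp add: w)
    qed
    show "\<bar>w i $ m\<bar> * norm (b i) \<le> fact ?n * real ?n ^ ?n" if "i < ?n" for i m
    proof -
      \<comment> \<open>The replaced row contributes a factor 1, so the minimum of index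
        \<open>i\<close> is missing from the bound; multiplying by \<open>norm (b i)\<close>
        completes the product controlled by \<open>prod_minima_le_det\<close>.\<close>
      have "\<bar>det (\<chi> r. if r = f i then axis m 1 else P $ r)\<bar>
          \<le> fact ?n * (\<Prod>r\<in>UNIV. if r = f i then 1 else norm (b (e r)))"
        by (rule abs_det_le) (auto simp: axis_def P_def component_le_norm_cart)
      then have "\<bar>det (\<chi> r. if r = f i then axis m 1 else P $ r)\<bar> * norm (b i)
          \<le> fact ?n * (\<Prod>r\<in>UNIV. if r = f i then 1 else norm (b (e r))) * norm (b i)"
        by (rule mult_right_mono) simp
      also have "\<dots> = fact ?n * (norm (b i) * (\<Prod>r\<in>UNIV - {f i}. norm (b (e r))))"
        by (simp add: prod.remove[of UNIV "f i"])
      also have "norm (b i) * (\<Prod>r\<in>UNIV - {f i}. norm (b (e r))) = (\<Prod>r\<in>UNIV. norm (b (e r)))"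
        by (simp add: prod.remove[of UNIV "f i" "\<lambda>r. norm (b (e r))"] ef[OF that])
      also have "(\<Prod>r\<in>UNIV. norm (b (e r))) = (\<Prod>i<?n. norm (b i))"
        by (rule prod.reindex_bij_betw[OF e])
      also have "fact ?n * (\<Prod>i<?n. norm (b i)) \<le> fact ?n * (real ?n ^ ?n * \<bar>det G\<bar>)"
        using prod_minima_le_det[OF inv M b] by (intro mult_left_mono) auto
      finally show ?thesis
        using detG by (simp add: w_def abs_mult field_simps)
    qed
  qed
qed

section \<open>Transference between a box and its reciprocal box\<close>

lemma has_indep_points_mono:
  assumes "has_indep_points k M v" "\<And>i. \<bar>v $ i\<bar> \<le> \<bar>v' $ i\<bar>"
  shows "has_indep_points k M v'"
proof -
  have "box_of v \<subseteq> box_of v'"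
    using assms(2) unfolding box_of_def by (auto intro: order.trans)
  then show ?thesis using assms(1) unfolding has_indep_points_def by blast
qed

lemma has_indep_points_fewer:
  assumes "has_indep_points k M v" "l \<le> k"
  shows "has_indep_points l M v"
proof -
  obtain S where S: "S \<subseteq> M \<inter> box_of v" "finite S" "card S = k" "independent S"
    using assms(1) unfolding has_indep_points_def by blast
  obtain S' where "S' \<subseteq> S" "card S' = l" "finite S'"
    using obtain_subset_with_card_n[of l S] S assms(2) by auto
  then show ?thesis
    using S independent_mono[OF S(4)] unfolding has_indep_points_def by (intro exI[of _ S']) blast
qed

text \<open>When no coordinate vanishes, the box of \<open>coord_inverse v\<close> is the polar body
  of the box of \<open>v\<close> up to a factor depending on the dimension. With
  \<open>inverse 0 = 0\<close> the map is an involution on all vectors.\<close>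

definition coord_inverse :: "real ^ 'n \<Rightarrow> real ^ 'n" where
  "coord_inverse v = (\<chi> i. inverse (v $ i))"

lemma coord_inverse_coord_inverse [simp]: "coord_inverse (coord_inverse v) = v"
  by (simp add: coord_inverse_def vec_eq_iff)

text \<open>The dimensions k and n + 1 - k add up to more than n, so some point of the first box and
  some dual point of the second are not orthogonal. Their inner product is a nonzero integer, while
  each of its n summands is at most \<open>\<bar>c\<bar>\<close> in absolute value.\<close>

lemma transference_lower:
  fixes \<Lambda> :: "(real ^ 'n) set"
  assumes k: "k \<in> {1..CARD('n)}" and v: "\<And>i. v $ i \<noteq> 0"
    and H: "has_indep_points k \<Lambda> v"
    and H': "has_indep_points (CARD('n) + 1 - k) (dual_lattice \<Lambda>) (c *\<^sub>R coord_inverse v)"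
  shows "1 \<le> real CARD('n) * \<bar>c\<bar>"
proof -
  obtain S where S: "S \<subseteq> \<Lambda> \<inter> box_of v" "finite S" "card S = k" "independent S"
    using H unfolding has_indep_points_def by blast
  obtain T where T: "T \<subseteq> dual_lattice \<Lambda> \<inter> box_of (c *\<^sub>R coord_inverse v)" "finite T"
      "card T = CARD('n) + 1 - k" "independent T"
    using H' unfolding has_indep_points_def by blast
  have "\<exists>x\<in>S. \<exists>y\<in>T. y \<bullet> x \<noteq> 0"
  proof (rule ccontr)
    assume "\<not> ?thesis"
    then have orth: "\<forall>y\<in>T. \<forall>x\<in>S. orthogonal y x" by (auto simp: orthogonal_def)
    have "T \<subseteq> {y. \<forall>x\<in>span S. orthogonal x y}"
      using orth by (auto intro: orthogonal_commute[THEN iffD1] orthogonal_to_span simp: orthogonal_commute)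
    then have "dim T \<le> dim {y. \<forall>x\<in>span S. orthogonal x y}" by (rule dim_subset)
    moreover have "dim {y \<in> UNIV. \<forall>x\<in>span S. orthogonal x y} + dim (span S) = dim (UNIV :: (real ^ 'n) set)"
      by (rule dim_subspace_orthogonal_to_vectors) auto
    moreover have "dim (span S) = k" "dim T = CARD('n) + 1 - k"
      using S T by (simp_all add: dim_eq_card_independent)
    ultimately show False using k by (simp add: dim_UNIV)
  qed
  then obtain x y where xy: "x \<in> S" "y \<in> T" "y \<bullet> x \<noteq> 0" by blast
  have "y \<bullet> x \<in> \<int>" using xy S T by (auto simp: dual_lattice_def)
  then have "1 \<le> \<bar>y \<bullet> x\<bar>" using xy(3) by (rule Ints_nonzero_abs_ge1)
  also have "\<dots> \<le> (\<Sum>i\<in>UNIV. \<bar>y $ i * x $ i\<bar>)"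
    by (simp add: inner_vec_def sum_abs)
  also have "\<dots> \<le> (\<Sum>i\<in>(UNIV :: 'n set). \<bar>c\<bar>)"
  proof (rule sum_mono)
    fix i
    have "\<bar>x $ i\<bar> \<le> \<bar>v $ i\<bar>" "\<bar>y $ i\<bar> \<le> \<bar>c * inverse (v $ i)\<bar>"
      using xy S T by (auto simp: box_of_def coord_inverse_def)
    then have "\<bar>y $ i * x $ i\<bar> \<le> \<bar>c * inverse (v $ i)\<bar> * \<bar>v $ i\<bar>"
      unfolding abs_mult by (intro mult_mono) auto
    then show "\<bar>y $ i * x $ i\<bar> \<le> \<bar>c\<bar>" using v[of i] by (simp add: abs_mult mult.assoc)
  qed
  finally show ?thesis by simp
qed

definition coord_scale :: "real ^ 'n \<Rightarrow> real ^ 'n \<Rightarrow> real ^ 'n" where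
  "coord_scale c x = (\<chi> i. c $ i * x $ i)"

lemma linear_coord_scale: "linear (coord_scale c)"
  by (rule linearI) (simp_all add: coord_scale_def vec_eq_iff algebra_simps)

lemma inj_coord_scale:
  assumes "\<And>i. c $ i \<noteq> 0"
  shows "inj (coord_scale c)"
  using assms by (intro injI) (simp add: coord_scale_def vec_eq_iff)

lemma independent_coord_scale:
  assumes c: "\<And>i. c $ i \<noteq> 0" and "independent S"
  shows "independent (coord_scale c ` S)"
  using linear_independent_injective_image[OF linear_coord_scale assms(2)]
    inj_on_subset[OF inj_coord_scale[OF c]] by blast

lemma card_coord_scale:
  assumes "\<And>i. c $ i \<noteq> 0"
  shows "card (coord_scale c ` S) = card S"
  using inj_on_subset[OF inj_coord_scale[OF assms]] by (intro card_image) blast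

text \<open>Rescaling by \<open>coord_inverse v\<close> turns the box into the cube of all vectors
  with entries at most 1. If k independent points are missing there, every minimum from the k-th on
  exceeds 1, and the bound in \<open>dual_vectors_of_minima\<close> then confines the dual vectors
  with these indices to a cube of constant size.\<close>

lemma transference_upper:
  fixes \<Lambda> :: "(real ^ 'n) set"
  assumes \<Lambda>: "full_rank_lattice \<Lambda>" and k: "k \<in> {1..CARD('n)}" and v: "\<And>i. v $ i \<noteq> 0"
    and H: "\<not> has_indep_points k \<Lambda> v"
  shows "has_indep_points (CARD('n) + 1 - k) (dual_lattice \<Lambda>)
    ((fact CARD('n) * real CARD('n) ^ CARD('n)) *\<^sub>R coord_inverse v)"
proof -
  let ?n = "CARD('n)"
  obtain B :: "real ^ 'n ^ 'n" where B: "invertible B" "\<Lambda> = {B *v z | z. \<forall>i. z $ i \<in> \<int>}"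
    using \<Lambda> unfolding full_rank_lattice_def is_lattice_basis_def by blast
  let ?D = "coord_scale (coord_inverse v)"
  have D0: "coord_inverse v $ i \<noteq> 0" for i using v by (simp add: coord_inverse_def)
  have scale_D: "coord_scale v (?D x) = x" "?D (coord_scale v x) = x" for x
    using v by (simp_all add: coord_scale_def coord_inverse_def vec_eq_iff)
  define G :: "real ^ 'n ^ 'n" where "G = (\<chi> i. (1 / v $ i) *s (B $ i))"
  define M where "M = {G *v z | z. \<forall>i. z $ i \<in> \<int>}"
  have Gz: "G *v z = ?D (B *v z)" for z
    by (simp add: vec_eq_iff matrix_vector_mul_component G_def coord_scale_def coord_inverse_def
        scalar_mult_eq_scaleR inverse_eq_divide)
  have M\<Lambda>: "M = ?D ` \<Lambda>" unfolding M_def B(2) Gz by blast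
  have "det G = (\<Prod>i\<in>UNIV. 1 / v $ i) * det B"
    unfolding G_def by (subst det_rows_mul) simp
  then have invG: "invertible G"
    using B(1) v by (simp add: invertible_det_nz)
  obtain b where b: "attains_minima M ?n b"
    using ex_attains_minima[OF invG M_def] by blast
  obtain q w where q: "q \<noteq> 0" and wM: "\<And>i. i < ?n \<Longrightarrow> w i \<in> dual_lattice M"
    and wb: "\<And>i j. i < ?n \<Longrightarrow> j < ?n \<Longrightarrow> w i \<bullet> b j = (if i = j then q else 0)"
    and wle: "\<And>i m. i < ?n \<Longrightarrow> \<bar>w i $ m\<bar> * norm (b i) \<le> fact ?n * real ?n ^ ?n"
    using dual_vectors_of_minima[OF invG M_def b] by blast
  \<comment> \<open>Otherwise the first k minimal vectors lie in the Euclidean unit ball, hence in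
    the cube, and scaling back gives k independent points in the box of \<open>v\<close>.\<close>
  have big: "norm (b (k - 1)) > 1"
  proof (rule ccontr)
    assume "\<not> ?thesis"
    moreover have "norm (b i) \<le> norm (b (k - 1))" if "i < k" for i
      by (rule attains_minima_norm_mono[OF b]) (use that k in auto)
    ultimately have le1: "norm (b i) \<le> 1" if "i < k" for i
      using that by force
    have "b i \<in> M" if "i < k" for i using b that k unfolding attains_minima_def by auto
    then have "coord_scale v (b i) \<in> \<Lambda>" if "i < k" for i
      using that scale_D(1) unfolding M\<Lambda> by (metis imageE)
    moreover have "coord_scale v (b i) \<in> box_of v" if "i < k" for i
      unfolding box_of_def
    proof (intro CollectI allI)
      fix m
      have "\<bar>b i $ m\<bar> \<le> 1"
        using le1[OF that] component_le_norm_cart[of "b i" m] by linarith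
      then show "\<bar>coord_scale v (b i) $ m\<bar> \<le> \<bar>v $ m\<bar>"
        by (simp add: coord_scale_def abs_mult mult_left_le)
    qed
    moreover have "independent (coord_scale v ` (b ` {..<k}))" "card (coord_scale v ` (b ` {..<k})) = k"
      using attains_minima_independent[OF b, of k] k
      by (simp_all add: independent_coord_scale[OF v] card_coord_scale[OF v])
    ultimately have "has_indep_points k \<Lambda> v"
      unfolding has_indep_points_def by (intro exI[of _ "coord_scale v ` (b ` {..<k})"]) auto
    then show False using H by blast
  qed
  \<comment> \<open>The indices k - 1, ..., n - 1 number exactly n + 1 - k.\<close>
  define I where "I = {k - 1..<?n}"
  have bigI: "norm (b i) > 1" if "i \<in> I" for i
    using attains_minima_norm_mono[OF b, of "k - 1" i] that big by (auto simp: I_def)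
  have iI: "i < ?n" if "i \<in> I" for i using that by (simp add: I_def)
  \<comment> \<open>A diagonal map is self-adjoint, so \<open>?D\<close> carries the dual of the
    rescaled lattice into the dual of \<open>\<Lambda>\<close>; it also carries the cube to the
    reciprocal box.\<close>
  define y where "y i = ?D (w i)" for i
  have injw: "inj_on w I"
  proof (rule inj_onI)
    fix i j assume ij: "i \<in> I" "j \<in> I" "w i = w j"
    show "i = j"
    proof (rule ccontr)
      assume "i \<noteq> j"
      then show False using wb[OF iI[OF ij(1)] iI[OF ij(1)]] wb[OF iI[OF ij(2)] iI[OF ij(1)]] q ij(3) by simp
    qed
  qed
  have indw: "independent (w ` I)"
  proof (rule independent_if_scalars_zero)
    fix f x assume s: "(\<Sum>x\<in>w ` I. f x *\<^sub>R x) = 0" and "x \<in> w ` I"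
    then obtain i where i: "i \<in> I" "x = w i" by blast
    have "0 = (\<Sum>x\<in>w ` I. f x *\<^sub>R x) \<bullet> b i" using s by simp
    also have "\<dots> = (\<Sum>j\<in>I. f (w j) * (w j \<bullet> b i))"
      using injw by (simp add: sum.reindex inner_sum_left)
    also have "\<dots> = (\<Sum>j\<in>I. if j = i then f (w j) * q else 0)"
      using wb iI i by (intro sum.cong) auto
    also have "\<dots> = f (w i) * q" using i by (simp add: I_def)
    finally show "f x = 0" using q i by simp
  qed (simp add: I_def)
  have yI: "y ` I = ?D ` (w ` I)" by (auto simp: y_def)
  have "independent (y ` I)" unfolding yI
    by (rule independent_coord_scale[OF D0 indw])
  moreover have "card (y ` I) = ?n + 1 - k"
    using k unfolding yI card_coord_scale[OF D0] card_image[OF injw] by (auto simp: I_def)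
  moreover have "y i \<in> dual_lattice \<Lambda>" if "i \<in> I" for i
    unfolding dual_lattice_def
  proof (intro CollectI ballI)
    fix z assume "z \<in> \<Lambda>"
    then have "w i \<bullet> ?D z \<in> \<int>" using wM[OF iI[OF that]] by (auto simp: M\<Lambda> dual_lattice_def)
    moreover have "w i \<bullet> ?D z = y i \<bullet> z" by (simp add: y_def coord_scale_def inner_vec_def mult_ac)
    ultimately show "y i \<bullet> z \<in> \<int>" by simp
  qed
  moreover have "y i \<in> box_of ((fact ?n * real ?n ^ ?n) *\<^sub>R coord_inverse v)" if "i \<in> I" for i
    unfolding box_of_def
  proof (intro CollectI allI)
    fix m
    have "\<bar>w i $ m\<bar> * 1 \<le> \<bar>w i $ m\<bar> * norm (b i)"
      using bigI[OF that] by (intro mult_left_mono) auto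
    then have "\<bar>w i $ m\<bar> \<le> fact ?n * real ?n ^ ?n"
      using wle[OF iI[OF that], of m] by simp
    then show "\<bar>y i $ m\<bar> \<le> \<bar>((fact ?n * real ?n ^ ?n) *\<^sub>R coord_inverse v) $ m\<bar>"
      by (simp add: y_def coord_scale_def coord_inverse_def abs_mult mult_left_mono mult.commute)
  qed
  ultimately show ?thesis
    unfolding has_indep_points_def by (intro exI[of _ "y ` I"]) (auto simp: I_def)
qed

text \<open>\<open>R\<close> dominates all minimal vectors at once. Boxes containing this cube
  always succeed, which is what bounds the critical rates from below.\<close>

lemma ex_cube_has_indep_points:
  fixes \<Lambda> :: "(real ^ 'n) set"
  assumes \<Lambda>: "full_rank_lattice \<Lambda>" and k: "k \<le> CARD('n)"
  obtains R where "R > 0" "\<And>v. (\<And>i. \<bar>v $ i\<bar> \<ge> R) \<Longrightarrow> has_indep_points k \<Lambda> v"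
proof -
  obtain B :: "real ^ 'n ^ 'n" where B: "invertible B" "\<Lambda> = {B *v z | z. \<forall>i. z $ i \<in> \<int>}"
    using \<Lambda> unfolding full_rank_lattice_def is_lattice_basis_def by blast
  obtain b where b: "attains_minima \<Lambda> CARD('n) b"
    using ex_attains_minima[OF B] by blast
  define R where "R = 1 + (\<Sum>i<CARD('n). norm (b i))"
  show ?thesis
  proof
    show "R > 0" unfolding R_def by (simp add: add_pos_nonneg sum_nonneg)
    fix v :: "real ^ 'n" assume v: "\<And>i. \<bar>v $ i\<bar> \<ge> R"
    have "b i \<in> \<Lambda> \<inter> box_of v" if i: "i < CARD('n)" for i
    proof
      show "b i \<in> \<Lambda>" using b i unfolding attains_minima_def by blast
      have "norm (b i) \<le> R"
        unfolding R_def using member_le_sum[of i "{..<CARD('n)}" "\<lambda>i. norm (b i)"] i by simp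
      then show "b i \<in> box_of v"
        unfolding box_of_def using v component_le_norm_cart[of "b i"]
        by (auto intro: order.trans[OF _ order.trans])
    qed
    then have "has_indep_points CARD('n) \<Lambda> v"
      unfolding has_indep_points_def using attains_minima_independent[OF b order.refl]
      by (intro exI[of _ "b ` {..<CARD('n)}"]) auto
    then show "has_indep_points k \<Lambda> v" using k by (rule has_indep_points_fewer)
  qed
qed

text \<open>The transposed inverse of a basis matrix is a basis of the dual, because pairing with
  the original basis reduces to pairing coordinate vectors, as in \<open>inn\<close>.\<close>

lemma full_rank_dual_lattice:
  assumes "full_rank_lattice (\<Lambda> :: (real ^ 'n) set)"
  shows "full_rank_lattice (dual_lattice \<Lambda>)"
proof -
  obtain B :: "real ^ 'n ^ 'n" where B: "invertible B" "\<Lambda> = {B *v z | z. \<forall>i. z $ i \<in> \<int>}"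
    using assms unfolding full_rank_lattice_def is_lattice_basis_def by blast
  obtain C where C: "B ** C = mat 1" "C ** B = mat 1"
    using B(1) unfolding invertible_def by blast
  have inn: "(transpose C *v y) \<bullet> (B *v z) = y \<bullet> z" for y z
    by (metis C(2) dot_lmul_matrix matrix_vector_mul_assoc matrix_vector_mul_lid transpose_matrix_vector)
  have "dual_lattice \<Lambda> = {transpose C *v z | z. \<forall>i. z $ i \<in> \<int>}"
  proof (intro equalityI subsetI)
    fix w assume w: "w \<in> dual_lattice \<Lambda>"
    define y where "y = transpose B *v w"
    have "transpose C ** transpose B = mat 1" by (metis C(1) matrix_transpose_mul transpose_mat)
    then have wy: "w = transpose C *v y"
      unfolding y_def by (simp only: matrix_vector_mul_assoc matrix_vector_mul_lid)
    have "y $ i \<in> \<int>" for i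
    proof -
      have "y $ i = w \<bullet> (B *v axis i 1)" unfolding wy inn by (simp add: inner_axis)
      moreover have "B *v axis i 1 \<in> \<Lambda>"
        unfolding B(2) by (intro CollectI exI[of _ "axis i 1"]) (simp add: axis_def)
      ultimately show ?thesis using w by (auto simp: dual_lattice_def)
    qed
    then show "w \<in> {transpose C *v z | z. \<forall>i. z $ i \<in> \<int>}" using wy by blast
  next
    fix w assume "w \<in> {transpose C *v z | z. \<forall>i. z $ i \<in> \<int>}"
    then obtain y where y: "w = transpose C *v y" "\<And>i. y $ i \<in> \<int>" by blast
    show "w \<in> dual_lattice \<Lambda>"
      unfolding dual_lattice_def B(2)
    proof safe
      fix z :: "real ^ 'n" assume "\<forall>i. z $ i \<in> \<int>"
      then show "w \<bullet> (B *v z) \<in> \<int>"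
        unfolding y(1) inn unfolding inner_vec_def using y(2) by (intro Ints_sum) auto
    qed
  qed
  moreover have "invertible (transpose C)"
    using C(1) B(1) det_mul[of B C] by (auto simp: invertible_det_nz)
  ultimately show ?thesis
    unfolding full_rank_lattice_def is_lattice_basis_def by blast
qed

section \<open>Exponents\<close>

lemma geo_mean_abs_eq: "geo_mean_abs (v :: real ^ 'n) = (\<Prod>i\<in>UNIV. \<bar>v $ i\<bar>) powr (1 / real CARD('n))"
  unfolding geo_mean_abs_def by (rule prod_powr_distrib[symmetric])

lemma geo_mean_abs_scaleR: "geo_mean_abs (s *\<^sub>R v) = \<bar>s\<bar> * geo_mean_abs (v :: real ^ 'n)"
proof -
  have "(\<bar>s\<bar> ^ CARD('n)) powr (1 / real CARD('n)) = \<bar>s\<bar>"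
  proof (cases "s = 0")
    case False
    then have "\<bar>s\<bar> ^ CARD('n) = \<bar>s\<bar> powr real CARD('n)" by (simp add: powr_realpow)
    then show ?thesis by (simp add: powr_powr)
  qed simp
  then show ?thesis
    unfolding geo_mean_abs_eq by (simp add: abs_mult prod.distrib powr_mult prod_nonneg)
qed

lemma geo_mean_abs_eq_1_iff: "geo_mean_abs (u :: real ^ 'n) = 1 \<longleftrightarrow> (\<Prod>i\<in>UNIV. \<bar>u $ i\<bar>) = 1"
proof
  assume "geo_mean_abs u = 1"
  then have "((\<Prod>i\<in>UNIV. \<bar>u $ i\<bar>) powr (1 / real CARD('n))) powr real CARD('n) = 1"
    unfolding geo_mean_abs_eq by simp
  then show "(\<Prod>i\<in>UNIV. \<bar>u $ i\<bar>) = 1"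
    unfolding powr_powr by (simp add: prod_nonneg)
qed (simp add: geo_mean_abs_eq)

lemma geo_mean_abs_coord_inverse:
  "geo_mean_abs u = 1 \<Longrightarrow> geo_mean_abs (coord_inverse u) = 1"
  unfolding geo_mean_abs_eq_1_iff using prod_inversef[of "\<lambda>i. \<bar>u $ i\<bar>" UNIV]
  by (simp add: coord_inverse_def o_def)

lemma geo_mean_abs_1_nonzero: "geo_mean_abs u = 1 \<Longrightarrow> u $ i \<noteq> 0"
  unfolding geo_mean_abs_eq_1_iff by (metis UNIV_I abs_zero finite prod_zero zero_neq_one)

lemma infnorm_attained: "\<exists>i. infnorm (v :: real ^ 'n) = \<bar>v $ i\<bar>"
proof -
  have "infnorm v \<in> (\<lambda>b. \<bar>v \<bullet> b\<bar>) ` Basis"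
    unfolding infnorm_Max by (rule Max_in) auto
  then show ?thesis by (auto simp: Basis_vec_def inner_axis)
qed

lemma infnorm_ge_1:
  assumes "geo_mean_abs (u :: real ^ 'n) = 1"
  shows "infnorm u \<ge> 1"
proof (rule ccontr)
  assume lt: "\<not> infnorm u \<ge> 1"
  have "(\<Prod>i\<in>(UNIV :: 'n set). \<bar>u $ i\<bar>) \<le> (\<Prod>i\<in>(UNIV :: 'n set). infnorm u)"
    by (intro prod_mono) (auto simp: component_le_infnorm_cart)
  also have "\<dots> < 1" using lt by (simp add: power_less_one_iff infnorm_pos_le)
  finally show False using assms by (simp add: geo_mean_abs_eq_1_iff)
qed

text \<open>The absolute coordinates multiply to 1, so the inverse of one is the product of the
  other n - 1, each at most \<open>infnorm u\<close>. This is the source of the factor d - 1 in the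
  theorem.\<close>

lemma inverse_coord_le_infnorm_powr:
  assumes "geo_mean_abs (u :: real ^ 'n) = 1"
  shows "inverse \<bar>u $ i\<bar> \<le> infnorm u powr (real CARD('n) - 1)"
proof -
  have "\<bar>u $ i\<bar> * (\<Prod>j\<in>UNIV - {i}. \<bar>u $ j\<bar>) = 1"
    using assms unfolding geo_mean_abs_eq_1_iff by (simp add: prod.remove[of UNIV i])
  then have "inverse \<bar>u $ i\<bar> = (\<Prod>j\<in>UNIV - {i}. \<bar>u $ j\<bar>)"
    by (rule inverse_unique)
  also have "\<dots> \<le> (\<Prod>j\<in>UNIV - {i}. infnorm u)"
    by (intro prod_mono) (auto simp: component_le_infnorm_cart)
  also have "\<dots> = infnorm u ^ (CARD('n) - 1)" by (simp add: card_Diff_singleton)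
  also have "\<dots> = infnorm u powr (real CARD('n) - 1)"
  proof -
    have "CARD('n) \<ge> 1" by (simp add: Suc_leI)
    then show ?thesis
      using infnorm_ge_1[OF assms] by (subst powr_realpow[symmetric]) (auto simp: of_nat_diff)
  qed
  finally show ?thesis .
qed

lemma infnorm_coord_inverse_le:
  assumes "geo_mean_abs (u :: real ^ 'n) = 1"
  shows "infnorm (coord_inverse u) \<le> infnorm u powr (real CARD('n) - 1)"
  using infnorm_attained[of "coord_inverse u"] inverse_coord_le_infnorm_powr[OF assms]
  by (auto simp: coord_inverse_def)

text \<open>A large coordinate is balanced by its inverse in a second one, which is where dimension
  at least 2 enters. Uniform statements thereby become non-vacuous.\<close>

lemma ex_geo_mean_abs_1_infnorm_ge:
  assumes "CARD('n) \<ge> 2"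
  shows "\<exists>u :: real ^ 'n. geo_mean_abs u = 1 \<and> infnorm u \<ge> T"
proof -
  obtain i j :: 'n where ij: "i \<noteq> j"
    using assms card_le_Suc0_iff_eq[of "UNIV :: 'n set"] by (auto simp: numeral_2_eq_2)
  define t where "t = max T 1"
  have t: "t > 0" by (simp add: t_def)
  define u :: "real ^ 'n" where "u = (\<chi> m. if m = i then t else if m = j then inverse t else 1)"
  have "(\<Prod>m\<in>UNIV. \<bar>u $ m\<bar>) = \<bar>u $ i\<bar> * (\<bar>u $ j\<bar> * (\<Prod>m\<in>UNIV - {i} - {j}. \<bar>u $ m\<bar>))"
    using ij by (simp add: prod.remove[of UNIV i] prod.remove[of "UNIV - {i}" j])
  also have "(\<Prod>m\<in>UNIV - {i} - {j}. \<bar>u $ m\<bar>) = 1"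
    by (rule prod.neutral) (auto simp: u_def)
  finally have "geo_mean_abs u = 1"
    using ij t by (simp add: geo_mean_abs_eq_1_iff u_def)
  moreover have "infnorm u \<ge> T"
    using component_le_infnorm_cart[of u i] t by (auto simp: u_def t_def)
  ultimately show ?thesis by blast
qed

text \<open>For \<open>u = v / \<Pi>(v)\<close> the condition \<open>\<Pi>(v) = |v| powr (-\<gamma>)\<close> becomes \<open>v = |u| powr (-\<alpha>) u\<close> with
  \<open>\<alpha> = \<gamma> / (1 + \<gamma>)\<close>, that is, \<open>\<gamma> = \<alpha> / (1 - \<alpha>)\<close>.\<close>

definition attains_rate :: "nat \<Rightarrow> (real ^ 'n) set \<Rightarrow> real \<Rightarrow> bool" where
  "attains_rate k M \<alpha> \<longleftrightarrow> (\<forall>T. \<exists>u. geo_mean_abs u = 1 \<and> infnorm u \<ge> T \<and>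
     has_indep_points k M ((infnorm u powr (- \<alpha>)) *\<^sub>R u))"

definition attains_rate_uniformly :: "nat \<Rightarrow> (real ^ 'n) set \<Rightarrow> real \<Rightarrow> bool" where
  "attains_rate_uniformly k M \<alpha> \<longleftrightarrow> (\<exists>T. \<forall>u. geo_mean_abs u = 1 \<longrightarrow> infnorm u \<ge> T \<longrightarrow>
     has_indep_points k M ((infnorm u powr (- \<alpha>)) *\<^sub>R u))"

text \<open>For \<alpha> < 1 the power 1 - \<alpha> is positive, so \<open>v\<close> grows with
  \<open>u\<close>; these rates correspond to the exponents \<gamma> > -1.\<close>

lemma normalized_to_exponent:
  fixes u :: "real ^ 'n"
  assumes u: "geo_mean_abs u = 1" and a: "\<alpha> < 1"
  defines "v \<equiv> (infnorm u powr (- \<alpha>)) *\<^sub>R u"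
  shows "infnorm v = infnorm u powr (1 - \<alpha>)" "geo_mean_abs v = infnorm v powr (- (\<alpha> / (1 - \<alpha>)))"
proof -
  have N: "infnorm u \<ge> 1" using infnorm_ge_1[OF u] .
  then have "infnorm v = infnorm u powr (- \<alpha>) * infnorm u powr 1"
    by (simp add: v_def infnorm_mul)
  also have "\<dots> = infnorm u powr (1 - \<alpha>)"
    unfolding powr_add[symmetric] by simp
  finally show v: "infnorm v = infnorm u powr (1 - \<alpha>)" .
  have "geo_mean_abs v = infnorm u powr (- \<alpha>)"
    by (simp add: v_def geo_mean_abs_scaleR u)
  then show "geo_mean_abs v = infnorm v powr (- (\<alpha> / (1 - \<alpha>)))"
    using a by (simp add: v powr_powr)
qed

lemma exponent_to_normalized:
  fixes v :: "real ^ 'n"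
  assumes v: "geo_mean_abs v = infnorm v powr (- (\<alpha> / (1 - \<alpha>)))" "infnorm v \<ge> 1" and a: "\<alpha> < 1"
  defines "u \<equiv> (infnorm v powr (\<alpha> / (1 - \<alpha>))) *\<^sub>R v"
  shows "geo_mean_abs u = 1" "infnorm u = infnorm v powr (1 / (1 - \<alpha>))"
    "v = (infnorm u powr (- \<alpha>)) *\<^sub>R u"
proof -
  show "geo_mean_abs u = 1"
    using v by (simp add: u_def geo_mean_abs_scaleR powr_add[symmetric])
  have "infnorm u = infnorm v powr (\<alpha> / (1 - \<alpha>)) * infnorm v powr 1"
    using v(2) by (simp add: u_def infnorm_mul)
  also have "\<dots> = infnorm v powr (\<alpha> / (1 - \<alpha>) + 1)" by (rule powr_add[symmetric])
  also have "\<alpha> / (1 - \<alpha>) + 1 = 1 / (1 - \<alpha>)" using a by (simp add: field_simps)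
  finally show N: "infnorm u = infnorm v powr (1 / (1 - \<alpha>))" .
  have "infnorm u powr (- \<alpha>) = infnorm v powr (- (\<alpha> / (1 - \<alpha>)))"
    by (simp add: N powr_powr)
  then show "v = (infnorm u powr (- \<alpha>)) *\<^sub>R u"
    using v(2) by (simp add: u_def powr_add[symmetric])
qed

lemma powr_ge_of_ge:
  assumes "x \<ge> \<bar>T\<bar> powr (1 / e)" "e > 0"
  shows "x powr e \<ge> (T :: real)"
proof -
  have "T \<le> (\<bar>T\<bar> powr (1 / e)) powr e" using assms(2) by (simp add: powr_powr)
  also have "\<dots> \<le> x powr e" using assms by (intro powr_mono2) auto
  finally show ?thesis .
qed

lemma attains_rate_iff:
  fixes M :: "(real ^ 'n) set"
  assumes a: "\<alpha> < 1"
  shows "(\<forall>T. \<exists>v. infnorm v \<ge> T \<and> geo_mean_abs v = infnorm v powr (- (\<alpha> / (1 - \<alpha>))) \<and>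
    has_indep_points k M v) \<longleftrightarrow> attains_rate k M \<alpha>" (is "?L \<longleftrightarrow> ?R")
proof
  assume L: ?L
  show ?R unfolding attains_rate_def
  proof
    fix T
    \<comment> \<open>The bound 1 makes \<open>exponent_to_normalized\<close> applicable; the other
      term is the threshold of \<open>powr_ge_of_ge\<close> for the power 1 / (1 - \<alpha>)
      relating |u| to |v|.\<close>
    obtain v where v: "infnorm v \<ge> max 1 (\<bar>T\<bar> powr (1 / (1 / (1 - \<alpha>))))"
        "geo_mean_abs v = infnorm v powr (- (\<alpha> / (1 - \<alpha>)))" "has_indep_points k M v"
      using L by blast
    then have v1: "infnorm v \<ge> 1" by simp
    define u where "u = (infnorm v powr (\<alpha> / (1 - \<alpha>))) *\<^sub>R v"
    note u = exponent_to_normalized[OF v(2) v1 a, folded u_def]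
    have "infnorm u \<ge> T" unfolding u(2)
      by (rule powr_ge_of_ge) (use v(1) a in auto)
    then show "\<exists>u. geo_mean_abs u = 1 \<and> infnorm u \<ge> T \<and>
        has_indep_points k M ((infnorm u powr (- \<alpha>)) *\<^sub>R u)"
      using u v(3) by metis
  qed
next
  assume R: ?R
  show ?L
  proof
    fix T
    obtain u where u: "geo_mean_abs u = 1" "infnorm u \<ge> \<bar>T\<bar> powr (1 / (1 - \<alpha>))"
        "has_indep_points k M ((infnorm u powr (- \<alpha>)) *\<^sub>R u)"
      using R unfolding attains_rate_def by blast
    have "infnorm u powr (1 - \<alpha>) \<ge> T"
      by (rule powr_ge_of_ge) (use u a in auto)
    then show "\<exists>v. infnorm v \<ge> T \<and> geo_mean_abs v = infnorm v powr (- (\<alpha> / (1 - \<alpha>))) \<and>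
        has_indep_points k M v"
      using normalized_to_exponent[OF u(1) a] u(3) by metis
  qed
qed

lemma attains_rate_uniformly_iff:
  fixes M :: "(real ^ 'n) set"
  assumes a: "\<alpha> < 1"
  shows "(\<exists>T. \<forall>v. infnorm v \<ge> T \<longrightarrow> geo_mean_abs v = infnorm v powr (- (\<alpha> / (1 - \<alpha>))) \<longrightarrow>
    has_indep_points k M v) \<longleftrightarrow> attains_rate_uniformly k M \<alpha>" (is "?L \<longleftrightarrow> ?R")
proof
  assume ?L
  then obtain T where T: "\<And>v. infnorm v \<ge> T \<Longrightarrow>
      geo_mean_abs v = infnorm v powr (- (\<alpha> / (1 - \<alpha>))) \<Longrightarrow> has_indep_points k M v" by blast
  show ?R unfolding attains_rate_uniformly_def
  proof (intro exI[of _ "\<bar>T\<bar> powr (1 / (1 - \<alpha>))"] allI impI)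
    fix u :: "real ^ 'n"
    assume u: "geo_mean_abs u = 1" "infnorm u \<ge> \<bar>T\<bar> powr (1 / (1 - \<alpha>))"
    have "infnorm u powr (1 - \<alpha>) \<ge> T"
      by (rule powr_ge_of_ge) (use u a in auto)
    then show "has_indep_points k M ((infnorm u powr (- \<alpha>)) *\<^sub>R u)"
      using normalized_to_exponent[OF u(1) a] T by metis
  qed
next
  assume ?R
  then obtain T where T: "\<And>u. geo_mean_abs u = 1 \<Longrightarrow> infnorm u \<ge> T \<Longrightarrow>
      has_indep_points k M ((infnorm u powr (- \<alpha>)) *\<^sub>R u)"
    unfolding attains_rate_uniformly_def by blast
  show ?L
  proof (intro exI[of _ "max 1 (\<bar>T\<bar> powr (1 / (1 / (1 - \<alpha>))))"] allI impI)
    fix v :: "real ^ 'n"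
    assume v: "infnorm v \<ge> max 1 (\<bar>T\<bar> powr (1 / (1 / (1 - \<alpha>))))"
      "geo_mean_abs v = infnorm v powr (- (\<alpha> / (1 - \<alpha>)))"
    then have v1: "infnorm v \<ge> 1" by simp
    define u where "u = (infnorm v powr (\<alpha> / (1 - \<alpha>))) *\<^sub>R v"
    note u = exponent_to_normalized[OF v(2) v1 a, folded u_def]
    have "infnorm u \<ge> T" unfolding u(2)
      by (rule powr_ge_of_ge) (use v(1) a in auto)
    then show "has_indep_points k M v" using T[OF u(1)] u(3) by simp
  qed
qed

lemma has_indep_points_rate_mono:
  assumes "geo_mean_abs u = 1" "has_indep_points k M ((infnorm u powr (- \<alpha>')) *\<^sub>R u)" "\<alpha> \<le> \<alpha>'"
  shows "has_indep_points k M ((infnorm u powr (- \<alpha>)) *\<^sub>R u)"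
  using assms(2)
proof (rule has_indep_points_mono)
  fix i
  have "infnorm u powr (- \<alpha>') \<le> infnorm u powr (- \<alpha>)"
    using infnorm_ge_1[OF assms(1)] assms(3) by (intro powr_mono) auto
  then show "\<bar>((infnorm u powr (- \<alpha>')) *\<^sub>R u) $ i\<bar> \<le> \<bar>((infnorm u powr (- \<alpha>)) *\<^sub>R u) $ i\<bar>"
    by (simp add: abs_mult mult_right_mono)
qed

lemma attains_rate_antimono:
  "attains_rate k M \<alpha>' \<Longrightarrow> \<alpha> \<le> \<alpha>' \<Longrightarrow> attains_rate k M \<alpha>"
  unfolding attains_rate_def using has_indep_points_rate_mono by metis

lemma attains_rate_uniformly_antimono:
  "attains_rate_uniformly k M \<alpha>' \<Longrightarrow> \<alpha> \<le> \<alpha>' \<Longrightarrow> attains_rate_uniformly k M \<alpha>"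
  unfolding attains_rate_uniformly_def using has_indep_points_rate_mono by metis

text \<open>Every coordinate of \<open>u\<close> is at least |u| to the power -(n - 1) in absolute
  value, so for such a rate all sides of the rescaled box grow like a positive power of |u| and
  eventually contain the cube of \<open>ex_cube_has_indep_points\<close>.\<close>

lemma attains_rate_uniformly_low:
  fixes M :: "(real ^ 'n) set"
  assumes "full_rank_lattice M" "k \<le> CARD('n)" "\<alpha> < - (real CARD('n) - 1)"
  shows "attains_rate_uniformly k M \<alpha>"
proof -
  obtain R where R: "R > 0" "\<And>v. (\<And>i. \<bar>v $ i\<bar> \<ge> R) \<Longrightarrow> has_indep_points k M v"
    using ex_cube_has_indep_points[OF assms(1,2)] by blast
  define e where "e = - \<alpha> - (real CARD('n) - 1)"
  have e: "e > 0" using assms(3) by (simp add: e_def)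
  show ?thesis unfolding attains_rate_uniformly_def
  proof (intro exI[of _ "\<bar>R\<bar> powr (1 / e)"] allI impI, rule R(2))
    fix u :: "real ^ 'n" and i
    assume u: "geo_mean_abs u = 1" "infnorm u \<ge> \<bar>R\<bar> powr (1 / e)"
    have N: "infnorm u \<ge> 1" using infnorm_ge_1[OF u(1)] .
    have ui: "\<bar>u $ i\<bar> > 0" using geo_mean_abs_1_nonzero[OF u(1)] by simp
    have "inverse (infnorm u powr (real CARD('n) - 1)) \<le> \<bar>u $ i\<bar>"
      using inverse_coord_le_infnorm_powr[OF u(1), of i] ui le_imp_inverse_le[of "inverse \<bar>u $ i\<bar>"] by simp
    then have "infnorm u powr (- (real CARD('n) - 1)) \<le> \<bar>u $ i\<bar>"
      unfolding powr_minus .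
    then have "infnorm u powr (- \<alpha>) * infnorm u powr (- (real CARD('n) - 1)) \<le> infnorm u powr (- \<alpha>) * \<bar>u $ i\<bar>"
      by (rule mult_left_mono) simp
    moreover have "infnorm u powr (- \<alpha>) * infnorm u powr (- (real CARD('n) - 1)) = infnorm u powr e"
      unfolding powr_add[symmetric] e_def by (simp add: algebra_simps)
    moreover have "R \<le> infnorm u powr e"
      using powr_ge_of_ge[OF u(2) e] .
    ultimately show "R \<le> \<bar>((infnorm u powr (- \<alpha>)) *\<^sub>R u) $ i\<bar>"
      by (simp add: abs_mult)
  qed
qed

lemma attains_rate_uniformly_imp_attains_rate:
  fixes M :: "(real ^ 'n) set"
  assumes "CARD('n) \<ge> 2" "attains_rate_uniformly k M \<alpha>"
  shows "attains_rate k M \<alpha>"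
  unfolding attains_rate_def
proof
  fix T
  obtain T0 where T0: "\<And>u. geo_mean_abs u = 1 \<Longrightarrow> infnorm u \<ge> T0 \<Longrightarrow>
      has_indep_points k M ((infnorm u powr (- \<alpha>)) *\<^sub>R u)"
    using assms(2) unfolding attains_rate_uniformly_def by blast
  obtain u :: "real ^ 'n" where "geo_mean_abs u = 1" "infnorm u \<ge> max T T0"
    using ex_geo_mean_abs_1_infnorm_ge[OF assms(1)] by blast
  then show "\<exists>u. geo_mean_abs u = 1 \<and> infnorm u \<ge> T \<and> has_indep_points k M ((infnorm u powr (- \<alpha>)) *\<^sub>R u)"
    using T0 by (intro exI[of _ u]) auto
qed

section \<open>Transference of rates\<close>

text \<open>Meant for x = |u| and y = |1/u|, which bound each other only up to the power m = d - 1.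
  A nonnegative \<open>e\<close> uses the bound on \<open>x\<close>, a negative one the bound on
  \<open>y\<close>; the maximum covers both signs.\<close>

lemma powr_compare:
  fixes x y m e :: real
  assumes "x \<ge> 1" "y \<ge> 1" "m > 0" "x \<le> y powr m" "y \<le> x powr m"
  shows "x powr e \<le> y powr (max (e / m) (e * m))"
proof (cases "e \<ge> 0")
  case True
  have "x powr e \<le> (y powr m) powr e"
    using assms True by (intro powr_mono2) auto
  also have "\<dots> = y powr (e * m)" by (simp add: powr_powr mult.commute)
  also have "\<dots> \<le> y powr (max (e / m) (e * m))" using assms by (intro powr_mono) auto
  finally show ?thesis .
next
  case False
  have "x powr e = (x powr m) powr (e / m)" using assms by (simp add: powr_powr)
  also have "\<dots> \<le> y powr (e / m)"
    using assms False by (intro powr_mono2') (auto simp: divide_nonpos_pos)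
  also have "\<dots> \<le> y powr (max (e / m) (e * m))" using assms by (intro powr_mono) auto
  finally show ?thesis .
qed

lemma coord_inverse_scaleR: "coord_inverse (s *\<^sub>R u) = inverse s *\<^sub>R coord_inverse u"
  by (simp add: coord_inverse_def vec_eq_iff)

text \<open>Points for u meet dual points for w = 1/u. \<open>transference_lower\<close> keeps the
  product of the two scaling factors at least 1/n, whereas a rate \<beta> above the maximum would,
  by \<open>powr_compare\<close>, bound that product by a negative power of an arbitrarily large
  |w|.\<close>

lemma rate_transference_upper:
  fixes \<Lambda> :: "(real ^ 'n) set"
  assumes n: "CARD('n) \<ge> 2" and k: "k \<in> {1..CARD('n)}"
    and P: "attains_rate k \<Lambda> \<alpha>"
    and F: "attains_rate_uniformly (CARD('n) + 1 - k) (dual_lattice \<Lambda>) \<beta>"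
  defines "m \<equiv> real CARD('n) - 1"
  shows "\<beta> \<le> max (- \<alpha> / m) (- \<alpha> * m)"
proof (rule ccontr)
  assume not: "\<not> ?thesis"
  define e where "e = \<beta> - max (- \<alpha> / m) (- \<alpha> * m)"
  have e: "e > 0" using not unfolding e_def by linarith
  have m: "m > 0" using n by (simp add: m_def)
  obtain T0 where T0: "\<And>u. geo_mean_abs u = 1 \<Longrightarrow> infnorm u \<ge> T0 \<Longrightarrow>
      has_indep_points (CARD('n) + 1 - k) (dual_lattice \<Lambda>) ((infnorm u powr (- \<beta>)) *\<^sub>R u)"
    using F unfolding attains_rate_uniformly_def by blast
  \<comment> \<open>Beyond \<open>T1\<close> the dual points exist and |w| to the power
    \<open>e\<close> exceeds n. Next, |u| must pass the m-th power of \<open>T1\<close>, because |w|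
    may be as small as the m-th root of |u|.\<close>
  define T1 where "T1 = max T0 (\<bar>real CARD('n) + 1\<bar> powr (1 / e))"
  obtain u where u: "geo_mean_abs u = 1" "infnorm u \<ge> \<bar>T1\<bar> powr (1 / (1 / m))"
      and H: "has_indep_points k \<Lambda> ((infnorm u powr (- \<alpha>)) *\<^sub>R u)"
    using P unfolding attains_rate_def by blast
  define w where "w = coord_inverse u"
  have w: "geo_mean_abs w = 1" unfolding w_def by (rule geo_mean_abs_coord_inverse[OF u(1)])
  have uw: "u = coord_inverse w" by (simp add: w_def)
  have le: "infnorm u \<le> infnorm w powr m" "infnorm w \<le> infnorm u powr m"
    using infnorm_coord_inverse_le[OF u(1)] infnorm_coord_inverse_le[OF w]
    unfolding uw[symmetric] w_def[symmetric] m_def by auto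
  have ge1: "infnorm u \<ge> 1" "infnorm w \<ge> 1" using infnorm_ge_1 u(1) w by auto
  have "T1 \<le> infnorm u powr (1 / m)"
    by (rule powr_ge_of_ge[OF u(2)]) (use m in simp)
  also have "\<dots> \<le> (infnorm w powr m) powr (1 / m)"
    using le(1) ge1 m by (intro powr_mono2) auto
  also have "\<dots> = infnorm w" using m ge1 by (simp add: powr_powr)
  finally have wT: "infnorm w \<ge> T1" .
  \<comment> \<open>The inverse of the scaled \<open>u\<close> is |u| to the power \<alpha> times
    \<open>w\<close>; the second factor cancels that power, so this is the dual box at
    \<open>w\<close> in the form required by \<open>transference_lower\<close>.\<close>
  have H': "has_indep_points (CARD('n) + 1 - k) (dual_lattice \<Lambda>)
      ((infnorm w powr (- \<beta>) * infnorm u powr (- \<alpha>)) *\<^sub>R coord_inverse ((infnorm u powr (- \<alpha>)) *\<^sub>R u))"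
    using T0[OF w] wT ge1 unfolding coord_inverse_scaleR w_def[symmetric] T1_def by (simp add: mult.assoc)
  have nz: "((infnorm u powr (- \<alpha>)) *\<^sub>R u) $ i \<noteq> 0" for i
    using geo_mean_abs_1_nonzero[OF u(1)] ge1 by auto
  have "1 \<le> real CARD('n) * \<bar>infnorm w powr (- \<beta>) * infnorm u powr (- \<alpha>)\<bar>"
    by (rule transference_lower[OF k nz H H'])
  also have "\<dots> \<le> real CARD('n) * (infnorm w powr (- \<beta>) * infnorm w powr (max (- \<alpha> / m) (- \<alpha> * m)))"
    unfolding abs_mult using powr_compare[OF ge1 m le, of "- \<alpha>"] by (intro mult_left_mono mult_mono) auto
  also have "infnorm w powr (- \<beta>) * infnorm w powr (max (- \<alpha> / m) (- \<alpha> * m)) = infnorm w powr (- e)"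
    unfolding powr_add[symmetric] e_def by simp
  finally have "infnorm w powr e \<le> real CARD('n)"
    using ge1 by (simp add: powr_minus field_simps)
  moreover have "real CARD('n) + 1 \<le> infnorm w powr e"
    using wT e by (intro powr_ge_of_ge) (auto simp: T1_def)
  ultimately show False by linarith
qed

text \<open>The negation of \<open>attains_rate\<close> is failure for all large u, which
  \<open>transference_upper\<close> converts into success for all large w = 1/u. The gap between
  \<beta> and the minimum leaves a power of |w| that absorbs the constant \<open>C\<close>.\<close>

lemma rate_transference_lower:
  fixes \<Lambda> :: "(real ^ 'n) set"
  assumes n: "CARD('n) \<ge> 2" and k: "k \<in> {1..CARD('n)}" and \<Lambda>: "full_rank_lattice \<Lambda>"
    and P: "\<not> attains_rate k \<Lambda> \<alpha>"
  defines "m \<equiv> real CARD('n) - 1"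
  assumes b: "\<beta> < min (- \<alpha> / m) (- \<alpha> * m)"
  shows "attains_rate_uniformly (CARD('n) + 1 - k) (dual_lattice \<Lambda>) \<beta>"
proof -
  define C :: real where "C = fact CARD('n) * real CARD('n) ^ CARD('n)"
  have C: "C > 0" by (simp add: C_def)
  define e where "e = - \<beta> - max (\<alpha> / m) (\<alpha> * m)"
  have e: "e > 0" using b by (simp add: e_def)
  have m: "m > 0" using n by (simp add: m_def)
  obtain T where T: "\<And>u. geo_mean_abs u = 1 \<Longrightarrow> infnorm u \<ge> T \<Longrightarrow>
      \<not> has_indep_points k \<Lambda> ((infnorm u powr (- \<alpha>)) *\<^sub>R u)"
    using P unfolding attains_rate_def by blast
  show ?thesis unfolding attains_rate_uniformly_def
  \<comment> \<open>The first threshold makes \<open>C\<close> at most |w| to the power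
    \<open>e\<close>; the second makes |u|, which is at least the m-th root of |w|, reach
    \<open>T\<close>.\<close>
  proof (intro exI[of _ "max (\<bar>C\<bar> powr (1 / e)) (\<bar>T\<bar> powr (1 / (1 / m)))"] allI impI)
    fix w :: "real ^ 'n"
    assume w: "geo_mean_abs w = 1" "infnorm w \<ge> max (\<bar>C\<bar> powr (1 / e)) (\<bar>T\<bar> powr (1 / (1 / m)))"
    define u where "u = coord_inverse w"
    have u: "geo_mean_abs u = 1" unfolding u_def by (rule geo_mean_abs_coord_inverse[OF w(1)])
    have wu: "w = coord_inverse u" by (simp add: u_def)
    have le: "infnorm u \<le> infnorm w powr m" "infnorm w \<le> infnorm u powr m"
      using infnorm_coord_inverse_le[OF u] infnorm_coord_inverse_le[OF w(1)]
      unfolding wu[symmetric] u_def[symmetric] m_def by auto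
    have ge1: "infnorm u \<ge> 1" "infnorm w \<ge> 1" using infnorm_ge_1 u w(1) by auto
    have "T \<le> infnorm w powr (1 / m)"
      by (rule powr_ge_of_ge) (use w m in auto)
    also have "\<dots> \<le> (infnorm u powr m) powr (1 / m)"
      using le(2) ge1 m by (intro powr_mono2) auto
    also have "\<dots> = infnorm u" using m ge1 by (simp add: powr_powr)
    finally have "\<not> has_indep_points k \<Lambda> ((infnorm u powr (- \<alpha>)) *\<^sub>R u)" by (rule T[OF u])
    moreover have "((infnorm u powr (- \<alpha>)) *\<^sub>R u) $ i \<noteq> 0" for i
      using geo_mean_abs_1_nonzero[OF u] ge1 by auto
    ultimately have "has_indep_points (CARD('n) + 1 - k) (dual_lattice \<Lambda>)
        (C *\<^sub>R coord_inverse ((infnorm u powr (- \<alpha>)) *\<^sub>R u))"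
      unfolding C_def by (intro transference_upper[OF \<Lambda> k])
    then have "has_indep_points (CARD('n) + 1 - k) (dual_lattice \<Lambda>) ((C * infnorm u powr \<alpha>) *\<^sub>R w)"
      unfolding coord_inverse_scaleR wu[symmetric] by (simp add: powr_minus)
    then show "has_indep_points (CARD('n) + 1 - k) (dual_lattice \<Lambda>) ((infnorm w powr (- \<beta>)) *\<^sub>R w)"
    proof (rule has_indep_points_mono)
      fix i
      have "C * infnorm u powr \<alpha> \<le> infnorm w powr e * infnorm w powr (max (\<alpha> / m) (\<alpha> * m))"
        using powr_compare[OF ge1 m le] powr_ge_of_ge[of C e "infnorm w"] w(2) e C
        by (intro mult_mono) auto
      also have "\<dots> = infnorm w powr (- \<beta>)"
        unfolding powr_add[symmetric] e_def by simp
      finally show "\<bar>((C * infnorm u powr \<alpha>) *\<^sub>R w) $ i\<bar> \<le> \<bar>((infnorm w powr (- \<beta>)) *\<^sub>R w) $ i\<bar>"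
        using C by (simp add: abs_mult mult_right_mono)
    qed
  qed
qed

section \<open>Critical rates and exponents\<close>

text \<open>The map \<alpha> / (1 - \<alpha>) is an increasing bijection from the rates below 1 onto
  the exponents above -1, so it carries the critical rate to the supremum, and 1 to infinity. Since
  \<open>S\<close> is described only above -1, \<open>low\<close> is what brings the supremum into
  that range.\<close>

lemma threshold_of_rates:
  fixes S :: "real set" and P :: "real \<Rightarrow> bool"
  assumes S: "\<And>\<alpha>. \<alpha> < 1 \<Longrightarrow> \<alpha> / (1 - \<alpha>) \<in> S \<longleftrightarrow> P \<alpha>"
    and mono: "\<And>\<alpha> \<alpha>'. P \<alpha>' \<Longrightarrow> \<alpha> \<le> \<alpha>' \<Longrightarrow> P \<alpha>"
    and low: "\<And>\<alpha>. \<alpha> < - m \<Longrightarrow> P \<alpha>" and m: "m \<ge> -1"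
  obtains s where "- m \<le> s" "s \<le> 1" "\<And>\<alpha>. \<alpha> < s \<Longrightarrow> P \<alpha>" "\<And>\<alpha>. s < \<alpha> \<Longrightarrow> \<alpha> < 1 \<Longrightarrow> \<not> P \<alpha>"
    "Sup (ereal ` S) = (if s = 1 then \<infinity> else ereal (s / (1 - s)))"
proof -
  define A where "A = {\<alpha>. \<alpha> < 1 \<and> P \<alpha>}"
  define s where "s = Sup A"
  have bdd: "bdd_above A" by (auto simp: A_def bdd_above_def intro: less_imp_le)
  have lowA: "\<alpha> \<in> A" if "\<alpha> < - m" for \<alpha> using low[OF that] that m by (simp add: A_def)
  have ne: "A \<noteq> {}" using lowA[of "- m - 1"] by auto
  have s1: "s \<le> 1" unfolding s_def using ne by (intro cSup_least) (auto simp: A_def)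
  have sm: "- m \<le> s"
    by (rule dense_le) (use lowA cSup_upper[OF _ bdd] s_def in auto)
  have below: "P \<alpha>" if "\<alpha> < s" for \<alpha>
    using less_cSupD[OF ne that[unfolded s_def]] mono by (auto simp: A_def)
  have above: "\<not> P \<alpha>" if "s < \<alpha>" "\<alpha> < 1" for \<alpha>
  proof
    assume "P \<alpha>"
    then have "\<alpha> \<in> A" using that by (simp add: A_def)
    then show False using cSup_upper[OF _ bdd] that by (simp add: s_def not_less[symmetric])
  qed
  have \<gamma>S: "\<gamma> \<in> S \<longleftrightarrow> P (\<gamma> / (1 + \<gamma>))" if "\<gamma> > -1" for \<gamma>
  proof -
    have "\<gamma> / (1 + \<gamma>) < 1" "(\<gamma> / (1 + \<gamma>)) / (1 - \<gamma> / (1 + \<gamma>)) = \<gamma>"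
      using that by (simp_all add: field_simps)
    then show ?thesis using S by metis
  qed
  have "Sup (ereal ` S) = (if s = 1 then \<infinity> else ereal (s / (1 - s)))"
  proof (cases "s = 1")
    case True
    have "Sup (ereal ` S) = \<infinity>"
    proof (rule SUP_PInfty)
      fix n :: nat
      have "real n \<in> S" using \<gamma>S[of "real n"] below[of "real n / (1 + real n)"] True
        by (simp add: field_simps)
      then show "\<exists>\<gamma>\<in>S. ereal (real n) \<le> ereal \<gamma>" by blast
    qed
    then show ?thesis using True by simp
  next
    case False
    then have s: "s < 1" using s1 by simp
    have g1: "s / (1 - s) > -1" using s by (simp add: field_simps)
    have "Sup (ereal ` S) = ereal (s / (1 - s))"
    proof (rule Sup_eqI)
      fix y assume "y \<in> ereal ` S"
      then obtain \<gamma> where \<gamma>: "y = ereal \<gamma>" "\<gamma> \<in> S" by blast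
      have "\<gamma> \<le> s / (1 - s)"
      proof (rule ccontr)
        assume "\<not> ?thesis"
        then have gt: "\<gamma> > s / (1 - s)" "\<gamma> > -1" using g1 by auto
        then have "s < \<gamma> / (1 + \<gamma>)" "\<gamma> / (1 + \<gamma>) < 1" using s by (simp_all add: field_simps)
        then show False using above \<gamma>S[OF gt(2)] \<gamma>(2) by blast
      qed
      then show "y \<le> ereal (s / (1 - s))" using \<gamma> by simp
    next
      fix y assume y: "\<And>z. z \<in> ereal ` S \<Longrightarrow> z \<le> y"
      show "ereal (s / (1 - s)) \<le> y"
      proof (rule ccontr)
        assume "\<not> ?thesis"
        \<comment> \<open>The maximum with -1 keeps the intermediate \<gamma> where membership in
          \<open>S\<close> is described.\<close>
        then have "max y (ereal (-1)) < ereal (s / (1 - s))" using g1 by auto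
        then obtain \<gamma> where "max y (ereal (-1)) < ereal \<gamma>" "ereal \<gamma> < ereal (s / (1 - s))"
          using ereal_dense2 by blast
        then have \<gamma>: "y < ereal \<gamma>" "\<gamma> > -1" "\<gamma> < s / (1 - s)" by auto
        then have "\<gamma> / (1 + \<gamma>) < s" using s by (simp add: field_simps)
        then have "\<gamma> \<in> S" using below \<gamma>S[OF \<gamma>(2)] by blast
        then show False using y \<gamma>(1) by (metis image_eqI not_le)
      qed
    qed
    then show ?thesis using False by simp
  qed
  then show ?thesis using that sm s1 below above by blast
qed

lemma divide_le_mult:
  fixes d m :: real
  assumes "m \<ge> 1" "d \<ge> 0"
  shows "d / m \<le> d * m"
proof -
  have "d * 1 \<le> d * (m * m)" using assms by (intro mult_left_mono) (auto simp: mult_ge1_I)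
  then show ?thesis using assms by (simp add: field_simps)
qed

text \<open>Both bounds are limits of \<open>upper\<close> and \<open>lower\<close> as \<alpha>
  tends to \<open>s\<close>: moving \<alpha> by \<open>d\<close> moves them by at most d * m,
  because d / m \<le> d * m.\<close>

lemma threshold_bounds:
  fixes s t m :: real
  assumes m: "m \<ge> 1" and s: "- m \<le> s" "s \<le> 1" and t: "- m \<le> t"
    and upper: "\<And>\<alpha> \<beta>. \<alpha> < s \<Longrightarrow> \<beta> < t \<Longrightarrow> \<beta> \<le> max (- \<alpha> / m) (- \<alpha> * m)"
    and lower: "\<And>\<alpha> \<beta>. s < \<alpha> \<Longrightarrow> \<alpha> < 1 \<Longrightarrow> \<beta> < 1 \<Longrightarrow> \<beta> < min (- \<alpha> / m) (- \<alpha> * m) \<Longrightarrow> \<beta> \<le> t"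
  shows "min (- s / m) (- s * m) \<le> t" "t \<le> max (- s / m) (- s * m)"
proof -
  show "t \<le> max (- s / m) (- s * m)"
  proof (rule ccontr)
    assume not: "\<not> ?thesis"
    define M where "M = max (- s / m) (- s * m)"
    have M: "M < t" using not unfolding M_def by linarith
    \<comment> \<open>The shift costs at most half of the gap from \<open>M\<close> to
      \<open>t\<close>, so a rate three quarters of the way up contradicts
      \<open>upper\<close>.\<close>
    define d where "d = (t - M) / (2 * m)"
    have d: "d > 0" using M m by (simp add: d_def)
    have "- (s - d) / m = - s / m + d / m" "- (s - d) * m = - s * m + d * m"
      using m by (simp_all add: field_simps)
    then have "max (- (s - d) / m) (- (s - d) * m) \<le> M + d * m"
      using divide_le_mult[OF m, of d] d unfolding M_def by (auto simp: max_def)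
    also have "d * m = (t - M) / 2" using m by (simp add: d_def)
    finally have "max (- (s - d) / m) (- (s - d) * m) \<le> M + (t - M) / 2" .
    moreover have "(M + 3 * t) / 4 \<le> max (- (s - d) / m) (- (s - d) * m)"
      using d M by (intro upper) auto
    ultimately have "(M + 3 * t) / 4 \<le> M + (t - M) / 2" by (rule order.trans[rotated])
    then show False using M by (simp add: field_simps)
  qed
  show "min (- s / m) (- s * m) \<le> t"
  proof (rule ccontr)
    assume not: "\<not> ?thesis"
    define M where "M = min (- s / m) (- s * m)"
    have M: "t < M" using not unfolding M_def by linarith
    have "M \<le> - s * m" by (simp add: M_def)
    \<comment> \<open>The value s = 1 would give M \<le> -m \<le> t. Room below 1 is required to
      choose \<alpha> above \<open>s\<close>.\<close>
    then have s1: "s < 1" using M t s by (cases "s = 1") auto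
    have "M \<le> - s / m" by (simp add: M_def)
    also have "\<dots> \<le> 1" using s m by (simp add: field_simps)
    finally have M1: "M \<le> 1" .
    \<comment> \<open>The first term again limits the loss to half of the gap, the second keeps s +
      d below 1. The rate a quarter of the way from \<open>t\<close> to \<open>M\<close> then
      exceeds \<open>t\<close> but stays below the shifted bound.\<close>
    define d where "d = min ((M - t) / (2 * m)) ((1 - s) / 2)"
    have d: "d > 0" using M m s1 by (simp add: d_def)
    have dm: "d * m \<le> (M - t) / 2"
    proof -
      have "d * m \<le> (M - t) / (2 * m) * m" using m by (intro mult_right_mono) (auto simp: d_def)
      then show ?thesis using m by simp
    qed
    have "- (s + d) / m = - s / m - d / m" "- (s + d) * m = - s * m - d * m"
      using m by (simp_all add: field_simps)
    then have ge: "min (- (s + d) / m) (- (s + d) * m) \<ge> M - d * m"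
      using divide_le_mult[OF m, of d] d unfolding M_def by (auto simp: min_def)
    have "(M + 3 * t) / 4 < M - d * m" using dm M by (simp add: field_simps)
    then have "(M + 3 * t) / 4 < min (- (s + d) / m) (- (s + d) * m)"
      using ge by (rule less_le_trans)
    moreover have "s + d < 1" using s1 min.cobounded2[of "(M - t) / (2 * m)" "(1 - s) / 2"]
      unfolding d_def[symmetric] by (simp add: field_simps)
    ultimately have "(M + 3 * t) / 4 \<le> t"
      using d M M1 by (intro lower[of "s + d"]) auto
    then show False using M by simp
  qed
qed

text \<open>The expressions in the theorem are reciprocal rates: (1 - s) / s + 1 = 1 / s, and at s =
  1 the inverse of infinity is 0, so both sides are 1.\<close>

lemma inverse_exponent_plus_1:
  assumes "s \<noteq> 0" "s \<le> 1"
  shows "inverse (if s = 1 then \<infinity> else ereal (s / (1 - s))) + 1 = ereal (1 / s)"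
  using assms by (auto simp: one_ereal_def field_simps)

lemma exponent_sign:
  assumes "s \<le> 1"
  shows "(if s = 1 then \<infinity> else ereal (s / (1 - s))) > 0 \<longleftrightarrow> s > 0"
    "(if s = 1 then \<infinity> else ereal (s / (1 - s))) < 0 \<longleftrightarrow> s < 0"
    "(if s = 1 then \<infinity> else ereal (s / (1 - s))) = 0 \<longleftrightarrow> s = 0"
  using assms by (auto simp: zero_less_divide_iff divide_less_0_iff)

lemma inverse_rate_bounds:
  fixes s t m :: real
  assumes m: "m \<ge> 1" and s: "s > 0" and t: "s / m \<le> t" "t \<le> s * m"
  shows "(1 / s) / m \<le> 1 / t" "1 / t \<le> m * (1 / s)"
proof -
  have "t > 0" using s m t(1) by (smt (verit) divide_pos_pos)
  then show "(1 / s) / m \<le> 1 / t" "1 / t \<le> m * (1 / s)"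
    using assms by (simp_all add: field_simps)
qed

theorem theorem9:
  fixes \<Lambda> :: "(real ^ 'n) set" and k :: nat
  assumes "CARD('n) \<ge> 2"
    and "full_rank_lattice \<Lambda>"
    and "lattice_covolume \<Lambda> = 1"
    and "k \<in> {1..CARD('n)}"
  defines "a \<equiv> lattice_exponent k \<Lambda>"
    and "b \<equiv> uniform_lattice_exponent (CARD('n) + 1 - k) (dual_lattice \<Lambda>)"
  shows "(a > 0 \<and> b < 0 \<or> a < 0 \<and> b > 0 \<or> a = 0 \<and> b = 0) \<and>
    (\<forall>A B. (A = a \<and> B = b \<or> A = b \<and> B = a) \<and> A > 0 \<and> B < 0 \<longrightarrow>
       (inverse A + 1) / ereal (real CARD('n) - 1) \<le> - (inverse B + 1) \<and>
       - (inverse B + 1) \<le> ereal (real CARD('n) - 1) * (inverse A + 1))"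
proof -
  define m where "m = real CARD('n) - 1"
  have m: "m \<ge> 1" using assms(1) by (simp add: m_def)
  have k: "k \<le> CARD('n)" "CARD('n) + 1 - k \<le> CARD('n)" using assms(4) by auto
  let ?k' = "CARD('n) + 1 - k"
  have dual: "full_rank_lattice (dual_lattice \<Lambda>)" by (rule full_rank_dual_lattice[OF assms(2)])
  obtain s where s: "- m \<le> s" "s \<le> 1" and sP: "\<And>\<alpha>. \<alpha> < s \<Longrightarrow> attains_rate k \<Lambda> \<alpha>"
    and sN: "\<And>\<alpha>. s < \<alpha> \<Longrightarrow> \<alpha> < 1 \<Longrightarrow> \<not> attains_rate k \<Lambda> \<alpha>"
    and a: "a = (if s = 1 then \<infinity> else ereal (s / (1 - s)))"
  proof (rule threshold_of_rates)
    show "\<alpha> / (1 - \<alpha>) \<in> {\<gamma>. \<forall>T. \<exists>v. infnorm v \<ge> T \<and> geo_mean_abs v = infnorm v powr (-\<gamma>) \<and>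
        has_indep_points k \<Lambda> v} \<longleftrightarrow> attains_rate k \<Lambda> \<alpha>" if "\<alpha> < 1" for \<alpha>
      using attains_rate_iff[OF that] by simp
    show "attains_rate k \<Lambda> \<alpha>" if "\<alpha> < - m" for \<alpha>
      using attains_rate_uniformly_imp_attains_rate[OF assms(1)]
        attains_rate_uniformly_low[OF assms(2) k(1)] that by (simp add: m_def)
  qed (use m attains_rate_antimono in \<open>auto simp: a_def lattice_exponent_def\<close>)
  obtain t where t: "- m \<le> t" "t \<le> 1" and tP: "\<And>\<alpha>. \<alpha> < t \<Longrightarrow> attains_rate_uniformly ?k' (dual_lattice \<Lambda>) \<alpha>"
    and tN: "\<And>\<alpha>. t < \<alpha> \<Longrightarrow> \<alpha> < 1 \<Longrightarrow> \<not> attains_rate_uniformly ?k' (dual_lattice \<Lambda>) \<alpha>"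
    and b: "b = (if t = 1 then \<infinity> else ereal (t / (1 - t)))"
  proof (rule threshold_of_rates)
    show "\<alpha> / (1 - \<alpha>) \<in> {\<gamma>. \<exists>T. \<forall>v. infnorm v \<ge> T \<longrightarrow> geo_mean_abs v = infnorm v powr (-\<gamma>) \<longrightarrow>
        has_indep_points ?k' (dual_lattice \<Lambda>) v} \<longleftrightarrow> attains_rate_uniformly ?k' (dual_lattice \<Lambda>) \<alpha>"
      if "\<alpha> < 1" for \<alpha>
      using attains_rate_uniformly_iff[OF that] by simp
    show "attains_rate_uniformly ?k' (dual_lattice \<Lambda>) \<alpha>" if "\<alpha> < - m" for \<alpha>
      using attains_rate_uniformly_low[OF dual k(2)] that by (simp add: m_def)
  qed (use m attains_rate_uniformly_antimono in \<open>auto simp: b_def uniform_lattice_exponent_def\<close>)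
  have upper: "\<beta> \<le> max (- \<alpha> / m) (- \<alpha> * m)" if "\<alpha> < s" "\<beta> < t" for \<alpha> \<beta>
    using rate_transference_upper[OF assms(1,4) sP[OF that(1)] tP[OF that(2)]] by (simp add: m_def)
  have lower: "\<beta> \<le> t" if "s < \<alpha>" "\<alpha> < 1" "\<beta> < 1" "\<beta> < min (- \<alpha> / m) (- \<alpha> * m)" for \<alpha> \<beta>
  proof (rule ccontr)
    assume "\<not> \<beta> \<le> t"
    then show False
      using rate_transference_lower[OF assms(1,4,2) sN[OF that(1,2)]] that tN[of \<beta>] by (simp add: m_def)
  qed
  have lo: "min (- s / m) (- s * m) \<le> t"
    by (rule threshold_bounds(1)[OF m s t(1)]; (rule upper lower; assumption))
  have hi: "t \<le> max (- s / m) (- s * m)"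
    by (rule threshold_bounds(2)[OF m s t(1)]; (rule upper lower; assumption))
  \<comment> \<open>For positive \<open>s\<close> the minimum is -s * m and the maximum -s / m; for
    negative \<open>s\<close> they swap. Either way |t| lies between |s| / m and |s| * m.\<close>
  have pos: "s / m \<le> - t" "- t \<le> s * m" if "s > 0"
    using lo hi divide_le_mult[OF m, of s] that by (auto simp: min_def max_def split: if_splits)
  have neg: "(- s) / m \<le> t" "t \<le> (- s) * m" if "s < 0"
    using lo hi divide_le_mult[OF m, of "- s"] that by (auto simp: min_def max_def split: if_splits)
  have zero: "t = 0" if "s = 0" using lo hi that by simp
  have tneg: "t < 0" if "s > 0" using pos[OF that] that m by (smt (verit) divide_pos_pos)
  have tpos: "t > 0" if "s < 0" using neg[OF that] that m by (smt (verit) divide_pos_pos)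
  have signs: "a > 0 \<and> b < 0 \<or> a < 0 \<and> b > 0 \<or> a = 0 \<and> b = 0"
    unfolding a b exponent_sign[OF s(2)] exponent_sign[OF t(2)]
    using tneg tpos zero by linarith
  have bounds: "ereal (1 / x) / ereal m \<le> - ereal (1 / y) \<and> - ereal (1 / y) \<le> ereal m * ereal (1 / x)"
    if "x > 0" "x / m \<le> - y" "- y \<le> x * m" for x y
    using inverse_rate_bounds[OF m that] m by simp
  have "(inverse A + 1) / ereal m \<le> - (inverse B + 1) \<and> - (inverse B + 1) \<le> ereal m * (inverse A + 1)"
    if AB: "A = a \<and> B = b \<or> A = b \<and> B = a" "A > 0" "B < 0" for A B
    using AB(1)
  proof
    assume AB': "A = a \<and> B = b"
    then have "s > 0" using AB(2) exponent_sign[OF s(2)] a by metis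
    moreover from this have "inverse A + 1 = ereal (1 / s)" "inverse B + 1 = ereal (1 / t)"
      using AB' a b inverse_exponent_plus_1[of s] inverse_exponent_plus_1[of t] s t tneg by force+
    ultimately show ?thesis using bounds pos by metis
  next
    assume AB': "A = b \<and> B = a"
    then have sneg: "s < 0" using AB(3) exponent_sign[OF s(2)] a by metis
    then have tp: "t > 0" using tpos by blast
    have e: "inverse A + 1 = ereal (1 / t)" "inverse B + 1 = ereal (1 / s)"
      using AB' a b inverse_exponent_plus_1[of s] inverse_exponent_plus_1[of t] s t sneg tp by force+
    \<comment> \<open>The two-sided bound is symmetric in |s| and |t|, so \<open>bounds\<close>
      applies with \<open>t\<close> as the positive rate.\<close>
    have "t / m \<le> - s" "- s \<le> t * m" using neg[OF sneg] m by (simp_all add: field_simps)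
    then show ?thesis using bounds[OF tp] e by metis
  qed
  then show ?thesis using signs unfolding m_def by blast
qed

end
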